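(* Let $m\in\omega$, $m\geqslant 1$. Then $\mathbf{U}_m$ is indivisible.
   Context: $\mathbf{U}_m$ is the unique (up to isometry) countable ultrahomogeneous metric space whose finite subspaces are, up to isometry, exactly the finite metric spaces with all distances between distinct points in $\{1,\dots,m\}$. A metric space is ultrahomogeneous when every isometry between finite subspaces extends to an isometry of the space onto itself. A metric space $X$ is indivisible when for every integer $k\geqslant1$ and every $\chi:X\to\{0,\dots,k-1\}$ there is a subspace $\widetilde X\subset X$ isometric to $X$ on which $\chi$ is constant. *)

theory Defs
  imports "HOL-Analysis.Analysis"
begin

definition isometry_onto :: "'a metric \<Rightarrow> 'b metric \<Rightarrow> ('a \<Rightarrow> 'b) \<Rightarrow> bool" where
  "isometry_onto X Y f \<longleftrightarrow>
     bij_betw f (mspace X) (mspace Y) \<and>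
     (\<forall>x\<in>mspace X. \<forall>y\<in>mspace X. mdist Y (f x) (f y) = mdist X x y)"

definition isometric :: "'a metric \<Rightarrow> 'b metric \<Rightarrow> bool" where
  "isometric X Y \<longleftrightarrow> (\<exists>f. isometry_onto X Y f)"

definition ultrahomogeneous :: "'a metric \<Rightarrow> bool" where
  "ultrahomogeneous X \<longleftrightarrow>
     (\<forall>S T f. finite S \<and> S \<subseteq> mspace X \<and> finite T \<and> T \<subseteq> mspace X \<and>
        isometry_onto (submetric X S) (submetric X T) f \<longrightarrow>
        (\<exists>g. isometry_onto X X g \<and> (\<forall>x\<in>S. g x = f x)))"

definition distances_upto :: "nat \<Rightarrow> 'a metric \<Rightarrow> bool" where
  "distances_upto m X \<longleftrightarrow>
     (\<forall>x\<in>mspace X. \<forall>y\<in>mspace X. x \<noteq> y \<longrightarrow> mdist X x y \<in> real ` {1..m})"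

text \<open>
  \<open>is_U m X\<close> says that \<open>X\<close> is (a copy of) \<open>\<^bold>U\<^sub>m\<close>, which is determined by these properties
  up to isometry only. Every finite metric space is isometric to one whose points are natural
  numbers, so it suffices to let \<open>F\<close> range over the type \<open>nat metric\<close>.
\<close>

definition is_U :: "nat \<Rightarrow> 'a metric \<Rightarrow> bool" where
  "is_U m X \<longleftrightarrow>
     countable (mspace X) \<and>
     ultrahomogeneous X \<and>
     (\<forall>F :: nat metric. finite (mspace F) \<longrightarrow>
        ((\<exists>S. finite S \<and> S \<subseteq> mspace X \<and> isometric F (submetric X S)) \<longleftrightarrow> distances_upto m F))"

definition indivisible :: "'a metric \<Rightarrow> bool" where
  "indivisible X \<longleftrightarrow>
     (\<forall>k::nat. k \<ge> 1 \<longrightarrow> (\<forall>c \<in> mspace X \<rightarrow> {0..<k}.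
        \<exists>S. S \<subseteq> mspace X \<and> isometric (submetric X S) X \<and> c constant_on S))"

end

theory Submission
  imports Defs
begin

text \<open>
All distances in \<open>\<^bold>U\<^sub>m\<close> are integers, so the metric is handled as a function \<open>d\<close> with values in
\<open>nat\<close>. Up to isometry \<open>\<^bold>U\<^sub>m\<close> is the countable space in which every one-point extension of a finite
subspace \<open>Y\<close>, given by the function \<open>g\<close> of distances from the new point to \<open>Y\<close>, is realised by a
point of the space. Such a \<open>g\<close> (a Katetov function) is called a type over \<open>Y\<close>, and its smallest
value is its level: two points that realise a type of level \<open>s\<close> have distance at most \<open>2 * s\<close>.

For a set \<open>\<Gamma>\<close> of points, largeness of a type is defined by recursion on the level. A type of level 1
is large if every extension of level 1 to a finite superset is realised in \<open>\<Gamma>\<close>; a type of level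
\<open>s + 1\<close> is large if every extension of level \<open>s + 1\<close> can be extended further to a large type of level
\<open>s\<close>. The negation of this alternation of quantifiers produces, for the complement of \<open>\<Gamma>\<close>, an
alternation of the same form. Hence if a finite union of sets is large relative to a type, then one of the sets is
large relative to an extension of the same level (\<open>large_UN\<close>). The whole space is large relative to
every type, so some colour class \<open>\<Gamma>\<close> is large relative to the constant type \<open>m\<close> over some finite
\<open>F\<close>.

Largeness of that single type does not yet allow one to choose a copy of the space inside \<open>\<Gamma>\<close> point by
point, since a large type of high level only promises some extension of lower level, whose values
at the new points cannot be prescribed. But if every type of level 1 that is constantly \<open>m\<close> on \<open>F\<close>
is large, then the greedy construction succeeds (\<open>copy_in_colour\<close>). This stronger
property is reached by descending from level \<open>m\<close> to level 1, passing to a smaller copy of the space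
at each step: if all types of level \<open>r + 1\<close> that are \<open>m\<close> on \<open>F\<close> are large, then there is a subspace
\<open>E\<close>, again realising all types, in which all types of level \<open>r\<close> that are \<open>m\<close> on \<open>F\<close> are large, where
largeness is now computed inside \<open>E\<close> (\<open>refine\<close>).

The subspace \<open>E\<close> is the union of finite sets \<open>Y\<close> that grow by one point at a time. Next to \<open>Y\<close> there is
a finite set \<open>D\<close> containing it, whose other points serve as witnesses only, and every type of level
\<open>r\<close> over \<open>Y\<close> that is \<open>m\<close> on \<open>F\<close> has a hat: an extension to \<open>D\<close> that is large. Two hats are not allowed to
differ on \<open>D\<close> more than they differ on \<open>Y\<close>, nor to have a smaller sum on \<open>D\<close> than on \<open>Y\<close>. These two
conditions say that the metric on \<open>Y\<close> together with formal points realising the types over \<open>Y\<close> can be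
amalgamated with \<open>D\<close> (\<open>amalgamate\<close>), and they allow one to place the next point \<open>e\<close> of \<open>E\<close> so that a
hat stays compatible with every value that the type may take at \<open>e\<close>. The types
that have level \<open>r\<close> only because of their value at \<open>e\<close> can be given values above \<open>r\<close> on all of \<open>D\<close>, so
the hypothesis on level \<open>r + 1\<close> provides them with hats, over a larger \<open>D\<close>, provided that \<open>e\<close> is not
chosen before this has been done for all of them (\<open>stage_step\<close>).
\<close>

section \<open>Types over finite sets and amalgamation\<close>

definition katetov :: "('a \<Rightarrow> 'a \<Rightarrow> nat) \<Rightarrow> nat \<Rightarrow> 'a set \<Rightarrow> ('a \<Rightarrow> nat) \<Rightarrow> bool" where
  "katetov d m Y g \<longleftrightarrow> (\<forall>x\<in>Y. 1 \<le> g x \<and> g x \<le> m) \<and>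
     (\<forall>x\<in>Y. \<forall>y\<in>Y. g x \<le> g y + d x y \<and> d x y \<le> g x + g y)"

definition level_type :: "('a \<Rightarrow> 'a \<Rightarrow> nat) \<Rightarrow> nat \<Rightarrow> nat \<Rightarrow> 'a set \<Rightarrow> ('a \<Rightarrow> nat) \<Rightarrow> bool" where
  "level_type d m s Y g \<longleftrightarrow>
     finite Y \<and> katetov d m Y g \<and> (\<forall>y\<in>Y. s \<le> g y) \<and> (\<exists>y\<in>Y. g y = s)"

text \<open>
The functions \<open>f z\<close> are the distance functions, on \<open>D\<close>, of formal points \<open>z\<close>. The formal points \<open>z\<close> and
\<open>z'\<close> may be put at distance \<open>\<rho>\<close> exactly if \<open>\<rho>\<close> bounds the difference of \<open>f z\<close> and \<open>f z'\<close> from above and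
their sum from below; coherence says that both \<open>\<rho> = a z z'\<close> and \<open>\<rho> = b z z'\<close> satisfy one half of
this, so that every distance between \<open>a z z'\<close> and \<open>b z z'\<close> remains available.
\<close>

definition coherent :: "('a \<Rightarrow> 'a \<Rightarrow> nat) \<Rightarrow> nat \<Rightarrow> 'a set \<Rightarrow> 'i set \<Rightarrow> ('i \<Rightarrow> 'i \<Rightarrow> nat)
    \<Rightarrow> ('i \<Rightarrow> 'i \<Rightarrow> nat) \<Rightarrow> ('i \<Rightarrow> nat) \<Rightarrow> ('i \<Rightarrow> 'a \<Rightarrow> nat) \<Rightarrow> bool" where
  "coherent d m D Z a b lv f \<longleftrightarrow>
     (\<forall>z\<in>Z. katetov d m D (f z) \<and> (\<forall>x\<in>D. lv z \<le> f z x)) \<and>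
     (\<forall>z\<in>Z. \<forall>z'\<in>Z. \<forall>x\<in>D. f z x \<le> a z z' + f z' x \<and> b z z' \<le> f z x + f z' x)"

locale nat_metric =
  fixes X :: "'a set" and d :: "'a \<Rightarrow> 'a \<Rightarrow> nat" and m :: nat
  assumes d_zero: "x \<in> X \<Longrightarrow> y \<in> X \<Longrightarrow> d x y = 0 \<longleftrightarrow> x = y"
    and d_sym: "x \<in> X \<Longrightarrow> y \<in> X \<Longrightarrow> d x y = d y x"
    and d_tri: "x \<in> X \<Longrightarrow> y \<in> X \<Longrightarrow> z \<in> X \<Longrightarrow> d x z \<le> d x y + d y z"
    and d_le: "x \<in> X \<Longrightarrow> y \<in> X \<Longrightarrow> d x y \<le> m"

lemma katetovD:
  assumes "katetov d m Y g"
  shows "x \<in> Y \<Longrightarrow> 1 \<le> g x" "x \<in> Y \<Longrightarrow> g x \<le> m"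
    "x \<in> Y \<Longrightarrow> y \<in> Y \<Longrightarrow> g x \<le> g y + d x y"
    "x \<in> Y \<Longrightarrow> y \<in> Y \<Longrightarrow> d x y \<le> g x + g y"
  using assms unfolding katetov_def by blast+

lemma coherentD:
  assumes "coherent d m D Z a b lv f"
  shows "z \<in> Z \<Longrightarrow> katetov d m D (f z)"
    "z \<in> Z \<Longrightarrow> x \<in> D \<Longrightarrow> lv z \<le> f z x"
    "z \<in> Z \<Longrightarrow> z' \<in> Z \<Longrightarrow> x \<in> D \<Longrightarrow> f z x \<le> a z z' + f z' x"
    "z \<in> Z \<Longrightarrow> z' \<in> Z \<Longrightarrow> x \<in> D \<Longrightarrow> b z z' \<le> f z x + f z' x"
  using assms unfolding coherent_def by blast+

text \<open>
The formal points in \<open>L\<close> already have distances to all of \<open>D'\<close>, the others only to \<open>D\<close>. The extension is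
the shortest-path distance, cut off at \<open>m\<close>, in the amalgam: a path from \<open>z\<close> to \<open>x \<in> D'\<close> passes through a
point of \<open>D\<close> or through a formal point of \<open>L\<close>, the distance to the latter being \<open>a z l\<close>. The lower bound \<open>b\<close>
on sums survives because of the mixed triangle inequality between \<open>a\<close> and \<open>b\<close>.
\<close>

lemma (in nat_metric) amalgamate:
  fixes f :: "'i \<Rightarrow> 'a \<Rightarrow> nat"
  assumes DD: "D \<subseteq> D'" "D' \<subseteq> X" "finite D" and L: "finite L" "L \<subseteq> Z"
    and cD: "coherent d m D Z a b lv f" and cL: "coherent d m D' L a b lv f"
    and a0: "\<And>l. l \<in> L \<Longrightarrow> a l l = 0"
    and a_sym: "\<And>z z'. z \<in> Z \<Longrightarrow> z' \<in> Z \<Longrightarrow> a z z' = a z' z"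
    and a_tri: "\<And>z z' l. z \<in> Z \<Longrightarrow> z' \<in> Z \<Longrightarrow> l \<in> Z \<Longrightarrow> a z l \<le> a z z' + a z' l"
    and b_le: "\<And>z z'. z \<in> Z \<Longrightarrow> z' \<in> Z \<Longrightarrow> b z z' \<le> m"
    and ab: "\<And>z z' l l'. z \<in> Z \<Longrightarrow> z' \<in> Z \<Longrightarrow> l \<in> L \<Longrightarrow> l' \<in> L \<Longrightarrow> b z z' \<le> a z l + b l l' + a z' l'"
    and lv: "\<And>z. z \<in> Z \<Longrightarrow> 1 \<le> lv z \<and> lv z \<le> m"
    and alv: "\<And>z l. z \<in> Z \<Longrightarrow> l \<in> L \<Longrightarrow> lv z \<le> a z l + lv l"
  obtains f' where "\<And>z x. z \<in> Z \<Longrightarrow> x \<in> D \<Longrightarrow> f' z x = f z x"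
    "\<And>z x. z \<in> L \<Longrightarrow> x \<in> D' \<Longrightarrow> f' z x = f z x" "coherent d m D' Z a b lv f'"
proof -
  define V where "V z x = insert m ((\<lambda>w. f z w + d w x) ` D \<union> (\<lambda>l. a z l + f l x) ` L)" for z x
  define \<phi> where "\<phi> z x = Min (V z x)" for z x
  have fin: "finite (V z x)" "V z x \<noteq> {}" for z x
    unfolding V_def using DD(3) L(1) by auto
  have le_m: "\<phi> z x \<le> m" for z x
    unfolding \<phi>_def by (rule Min_le[OF fin(1)]) (simp add: V_def)
  have le_w: "\<phi> z x \<le> f z w + d w x" if "w \<in> D" for z x w
    unfolding \<phi>_def by (rule Min_le[OF fin(1)]) (use that in \<open>simp add: V_def\<close>)
  have le_l: "\<phi> z x \<le> a z l + f l x" if "l \<in> L" for z x l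
    unfolding \<phi>_def by (rule Min_le[OF fin(1)]) (use that in \<open>simp add: V_def\<close>)
  have cases: "\<phi> z x = m \<or> (\<exists>w\<in>D. \<phi> z x = f z w + d w x) \<or> (\<exists>l\<in>L. \<phi> z x = a z l + f l x)" for z x
  proof -
    have "\<phi> z x \<in> V z x" unfolding \<phi>_def by (rule Min_in[OF fin])
    then show ?thesis unfolding V_def by blast
  qed
  note kD = katetovD[OF coherentD(1)[OF cD]]
  note kL = katetovD[OF coherentD(1)[OF cL]]
  note cD' = coherentD(2-)[OF cD] and cL' = coherentD(2-)[OF cL]
  have DX: "x \<in> X" if "x \<in> D" for x using that DD by auto
  have D'X: "x \<in> X" if "x \<in> D'" for x using that DD by auto
  have LZ: "l \<in> Z" if "l \<in> L" for l using that L by auto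
  have eqD: "\<phi> z x = f z x" if z: "z \<in> Z" and x: "x \<in> D" for z x
  proof (rule antisym)
    show "\<phi> z x \<le> f z x" using le_w[OF x, of z x] d_zero[OF DX[OF x] DX[OF x]] by simp
    show "f z x \<le> \<phi> z x"
      using cases[of z x]
    proof (elim disjE bexE)
      assume "\<phi> z x = m" then show ?thesis using kD(2)[OF z x] by simp
    next
      fix w assume w: "w \<in> D" "\<phi> z x = f z w + d w x"
      then show ?thesis using kD(3)[OF z x w(1)] d_sym[OF DX DX, OF x w(1)] by simp
    next
      fix l assume "l \<in> L" "\<phi> z x = a z l + f l x"
      then show ?thesis using cD'(2)[OF z LZ x] by simp
    qed
  qed
  have lip: "\<phi> z x \<le> \<phi> z y + d x y" if z: "z \<in> Z" and x: "x \<in> D'" and y: "y \<in> D'" for z x y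
    using cases[of z y]
  proof (elim disjE bexE)
    assume "\<phi> z y = m" then show ?thesis using le_m[of z x] by simp
  next
    fix w assume w: "w \<in> D" "\<phi> z y = f z w + d w y"
    then show ?thesis
      using le_w[OF w(1), of z x] d_tri[OF DX D'X D'X, OF w(1) y x] d_sym[OF D'X D'X, OF x y] by simp
  next
    fix l assume l: "l \<in> L" "\<phi> z y = a z l + f l y"
    then show ?thesis using le_l[OF l(1), of z x] kL(3)[OF l(1) x y] by simp
  qed
  have sumle: "d x y \<le> \<phi> z x + \<phi> z y" if z: "z \<in> Z" and x: "x \<in> D'" and y: "y \<in> D'" for z x y
  proof -
    have w: "d x y \<le> f z w + d w x + \<phi> z y" if x: "x \<in> D'" and y: "y \<in> D'" and w: "w \<in> D" for x y w
    proof -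
      have *: "d x y \<le> d w x + d w y"
        using d_tri[OF D'X DX D'X, OF x w y] d_sym[OF DX D'X, OF w x] by simp
      show ?thesis using cases[of z y]
      proof (elim disjE bexE)
        assume "\<phi> z y = m" then show ?thesis using d_le[OF D'X D'X, OF x y] by simp
      next
        fix v assume v: "v \<in> D" "\<phi> z y = f z v + d v y"
        have "d w y \<le> d w v + d v y" using d_tri[OF DX DX D'X, OF w v(1) y] .
        then show ?thesis using * kD(4)[OF z w v(1)] v(2) by simp
      next
        fix l assume l: "l \<in> L" "\<phi> z y = a z l + f l y"
        have "f l w \<le> a z l + f z w" using cD'(2)[OF LZ z w, OF l(1)] a_sym[OF z LZ[OF l(1)]] by simp
        moreover have "d w y \<le> f l w + f l y" using kL(4)[OF l(1), of w y] w y DD by auto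
        ultimately show ?thesis using * l(2) by simp
      qed
    qed
    show ?thesis using cases[of z x]
    proof (elim disjE bexE)
      assume "\<phi> z x = m" then show ?thesis using d_le[OF D'X D'X, OF x y] by simp
    next
      fix w assume "w \<in> D" "\<phi> z x = f z w + d w x"
      then show ?thesis using w[OF x y] by simp
    next
      fix l assume l: "l \<in> L" "\<phi> z x = a z l + f l x"
      show ?thesis using cases[of z y]
      proof (elim disjE bexE)
        assume "\<phi> z y = m" then show ?thesis using d_le[OF D'X D'X, OF x y] by simp
      next
        fix w' assume w': "w' \<in> D" "\<phi> z y = f z w' + d w' y"
        then show ?thesis using w[OF y x w'(1)] d_sym[OF D'X D'X, OF x y] by simp
      next
        fix l' assume l': "l' \<in> L" "\<phi> z y = a z l' + f l' y"
        have "f l' x \<le> a l' l + f l x" using cL'(2)[OF l'(1) l(1) x] .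
        moreover have "a l' l \<le> a z l' + a z l"
          using a_tri[OF LZ z LZ, OF l'(1) l(1)] a_sym[OF z LZ, OF l'(1)] by simp
        moreover have "d x y \<le> f l' x + f l' y" using kL(4)[OF l'(1) x y] .
        ultimately show ?thesis using l l' by simp
      qed
    qed
  qed
  have aL: "\<phi> z x \<le> a z z' + \<phi> z' x" if z: "z \<in> Z" and z': "z' \<in> Z" and x: "x \<in> D'" for z z' x
    using cases[of z' x]
  proof (elim disjE bexE)
    assume "\<phi> z' x = m" then show ?thesis using le_m[of z x] by simp
  next
    fix w assume w: "w \<in> D" "\<phi> z' x = f z' w + d w x"
    then show ?thesis using le_w[OF w(1), of z x] cD'(2)[OF z z' w(1)] by simp
  next
    fix l assume l: "l \<in> L" "\<phi> z' x = a z' l + f l x"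
    then show ?thesis using le_l[OF l(1), of z x] a_tri[OF z z' LZ[OF l(1)]] by simp
  qed
  have bL: "b z z' \<le> \<phi> z x + \<phi> z' x" if z: "z \<in> Z" and z': "z' \<in> Z" and x: "x \<in> D'" for z z' x
  proof -
    have wlip: "\<phi> z w \<le> d w x + \<phi> z x" if "z \<in> Z" "w \<in> D" for z w
      using lip[OF that(1), of w x] that(2) DD x by auto
    show ?thesis using cases[of z x]
    proof (elim disjE bexE)
      assume "\<phi> z x = m" then show ?thesis using b_le[OF z z'] by simp
    next
      fix w assume w: "w \<in> D" "\<phi> z x = f z w + d w x"
      then show ?thesis using wlip[OF z' w(1)] eqD[OF z' w(1)] cD'(3)[OF z z' w(1)] by simp
    next
      fix l assume l: "l \<in> L" "\<phi> z x = a z l + f l x"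
      show ?thesis using cases[of z' x]
      proof (elim disjE bexE)
        assume "\<phi> z' x = m" then show ?thesis using b_le[OF z z'] by simp
      next
        fix w assume w: "w \<in> D" "\<phi> z' x = f z' w + d w x"
        then show ?thesis using wlip[OF z w(1)] eqD[OF z w(1)] cD'(3)[OF z z' w(1)] by simp
      next
        fix l' assume l': "l' \<in> L" "\<phi> z' x = a z' l' + f l' x"
        show ?thesis using ab[OF z z' l(1) l'(1)] cL'(3)[OF l(1) l'(1) x] l l' by simp
      qed
    qed
  qed
  have lvL: "lv z \<le> \<phi> z x" if z: "z \<in> Z" and x: "x \<in> D'" for z x
    using cases[of z x]
  proof (elim disjE bexE)
    assume "\<phi> z x = m" then show ?thesis using lv[OF z] by simp
  next
    fix w assume w: "w \<in> D" "\<phi> z x = f z w + d w x"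
    then show ?thesis using cD'(1)[OF z w(1)] by simp
  next
    fix l assume l: "l \<in> L" "\<phi> z x = a z l + f l x"
    then show ?thesis using alv[OF z l(1)] cL'(1)[OF l(1) x] by simp
  qed
  have eqL: "\<phi> l x = f l x" if l: "l \<in> L" and x: "x \<in> D'" for l x
  proof (rule antisym)
    show "\<phi> l x \<le> f l x" using le_l[OF l, of l x] a0[OF l] by simp
    show "f l x \<le> \<phi> l x" using cases[of l x]
    proof (elim disjE bexE)
      assume "\<phi> l x = m" then show ?thesis using kL(2)[OF l x] by simp
    next
      fix w assume w: "w \<in> D" "\<phi> l x = f l w + d w x"
      then show ?thesis using kL(3)[OF l x, of w] d_sym[OF DX[OF w(1)] D'X[OF x]] DD(1) by auto
    next
      fix l' assume l': "l' \<in> L" "\<phi> l x = a l l' + f l' x"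
      then show ?thesis using cL'(2)[OF l l'(1) x] by simp
    qed
  qed
  have "coherent d m D' Z a b lv \<phi>"
    unfolding coherent_def katetov_def
    using le_m lip sumle aL bL lvL lv by (meson order_trans)
  with eqD eqL show thesis by (rule that)
qed

section \<open>The range of distances between two types\<close>

text \<open>
For types \<open>g\<close> and \<open>g'\<close> over \<open>P\<close>, \<open>gap\<close> and \<open>sep\<close> are the smallest and the largest distance at which
realisations of \<open>g\<close> and \<open>g'\<close> can be placed, disregarding that distinct points have positive distance,
and \<open>lev\<close> is the level.
\<close>

definition gap :: "'p set \<Rightarrow> ('p \<Rightarrow> nat) \<Rightarrow> ('p \<Rightarrow> nat) \<Rightarrow> nat" where
  "gap P g g' = Max ((\<lambda>p. (g p - g' p) + (g' p - g p)) ` P)"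

definition sep :: "nat \<Rightarrow> 'p set \<Rightarrow> ('p \<Rightarrow> nat) \<Rightarrow> ('p \<Rightarrow> nat) \<Rightarrow> nat" where
  "sep m P g g' = Min (insert m ((\<lambda>p. g p + g' p) ` P))"

definition lev :: "'p set \<Rightarrow> ('p \<Rightarrow> nat) \<Rightarrow> nat" where
  "lev P g = Min (g ` P)"

lemma gap_sym: "gap P g g' = gap P g' g"
  unfolding gap_def by (simp add: add.commute)

lemma gap_cong:
  "(\<And>p. p \<in> P \<Longrightarrow> g p = h p) \<Longrightarrow> (\<And>p. p \<in> P \<Longrightarrow> g' p = h' p) \<Longrightarrow> gap P g g' = gap P h h'"
  unfolding gap_def by (simp cong: image_cong)

lemma sep_cong:
  "(\<And>p. p \<in> P \<Longrightarrow> g p = h p) \<Longrightarrow> (\<And>p. p \<in> P \<Longrightarrow> g' p = h' p) \<Longrightarrow> sep m P g g' = sep m P h h'"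
  unfolding sep_def by (simp cong: image_cong)

lemma lev_cong: "(\<And>p. p \<in> P \<Longrightarrow> g p = h p) \<Longrightarrow> lev P g = lev P h"
  unfolding lev_def by (simp cong: image_cong)

lemma gap_ge:
  assumes "finite P" "p \<in> P"
  shows "g p \<le> gap P g g' + g' p"
proof -
  have "(g p - g' p) + (g' p - g p) \<le> gap P g g'"
    unfolding gap_def using assms by (intro Max_ge) auto
  then show ?thesis by simp
qed

lemma gap_le:
  assumes "finite P" "P \<noteq> {}" "\<And>p. p \<in> P \<Longrightarrow> g p \<le> c + g' p" "\<And>p. p \<in> P \<Longrightarrow> g' p \<le> c + g p"
  shows "gap P g g' \<le> c"
proof -
  have "(g p - g' p) + (g' p - g p) \<le> c" if "p \<in> P" for p
    using assms(3,4)[OF that] by linarith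
  then show ?thesis unfolding gap_def using assms(1,2) by (subst Max_le_iff) auto
qed

lemma gap_refl: "finite P \<Longrightarrow> P \<noteq> {} \<Longrightarrow> gap P g g = 0"
  using gap_le[of P g 0 g] by simp

lemma gap_triangle:
  assumes "finite P" "P \<noteq> {}"
  shows "gap P g k \<le> gap P g h + gap P h k"
proof (rule gap_le[OF assms])
  fix p assume p: "p \<in> P"
  note ge = gap_ge[OF assms(1) p]
  show "g p \<le> gap P g h + gap P h k + k p" using ge[of g h] ge[of h k] by simp
  show "k p \<le> gap P g h + gap P h k + g p"
    using ge[of k h] ge[of h g] by (simp add: gap_sym[of P k h] gap_sym[of P h g])
qed

lemma gap_mono: "finite Q \<Longrightarrow> P \<subseteq> Q \<Longrightarrow> P \<noteq> {} \<Longrightarrow> gap P g h \<le> gap Q g h"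
  unfolding gap_def by (intro Max_mono) auto

lemma sep_le_m: "finite P \<Longrightarrow> sep m P g g' \<le> m"
  unfolding sep_def by (intro Min_le) auto

lemma sep_le: "finite P \<Longrightarrow> p \<in> P \<Longrightarrow> sep m P g g' \<le> g p + g' p"
  unfolding sep_def by (intro Min_le) auto

lemma sep_ge:
  assumes "finite P" "c \<le> m" "\<And>p. p \<in> P \<Longrightarrow> c \<le> g p + g' p"
  shows "c \<le> sep m P g g'"
  unfolding sep_def using assms by (subst Min_ge_iff) auto

lemma sep_antimono: "finite Q \<Longrightarrow> P \<subseteq> Q \<Longrightarrow> sep m Q g h \<le> sep m P g h"
  unfolding sep_def by (intro Min_antimono) auto

text \<open>
This is the mixed triangle inequality that \<open>amalgamate\<close> asks for.
\<close>

lemma sep_gap: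
  assumes "finite P" "P \<noteq> {}"
  shows "sep m P z z' \<le> gap P z l + sep m P l l' + gap P z' l'"
proof -
  have "sep m P l l' \<in> insert m ((\<lambda>p. l p + l' p) ` P)"
    unfolding sep_def using assms by (intro Min_in) auto
  then consider "sep m P l l' = m" | p where "p \<in> P" "sep m P l l' = l p + l' p" by auto
  then show ?thesis
  proof cases
    case 1 then show ?thesis using sep_le_m[OF assms(1), of m z z'] by simp
  next
    case 2
    then show ?thesis
      using sep_le[OF assms(1) 2(1), of m z z'] gap_ge[OF assms(1) 2(1), of z l]
        gap_ge[OF assms(1) 2(1), of z' l'] by simp
  qed
qed

lemma lev_le: "finite P \<Longrightarrow> p \<in> P \<Longrightarrow> lev P g \<le> g p"
  unfolding lev_def by (intro Min_le) auto

lemma lev_attained: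
  assumes "finite P" "P \<noteq> {}" obtains p where "p \<in> P" "g p = lev P g"
proof -
  have "lev P g \<in> g ` P" unfolding lev_def using assms by (intro Min_in) auto
  then show thesis using that by (metis imageE)
qed

lemma lev_gap:
  assumes "finite P" "P \<noteq> {}"
  shows "lev P z \<le> gap P z l + lev P l"
proof -
  obtain p where p: "p \<in> P" "l p = lev P l" using lev_attained[OF assms] .
  then show ?thesis using lev_le[OF assms(1) p(1), of z] gap_ge[OF assms(1) p(1), of z l] by simp
qed

lemma lev_eqI: "finite P \<Longrightarrow> p \<in> P \<Longrightarrow> g p = s \<Longrightarrow> (\<And>q. q \<in> P \<Longrightarrow> s \<le> g q) \<Longrightarrow> lev P g = s"
  using lev_attained[of P g] lev_le[of P p g] by (metis empty_iff order_antisym)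

lemma katetov_mono: "katetov d m Y g \<Longrightarrow> Z \<subseteq> Y \<Longrightarrow> katetov d m Z g"
  unfolding katetov_def by blast

lemma katetov_cong: "(\<And>y. y \<in> Y \<Longrightarrow> g y = h y) \<Longrightarrow> katetov d m Y g \<longleftrightarrow> katetov d m Y h"
  unfolding katetov_def by simp

section \<open>Systems of large types\<close>

text \<open>
\<open>T s Y g\<close> is meant to say that \<open>g\<close> is a large type of level \<open>s\<close> over \<open>Y\<close>. Only the closure
properties of largeness are recorded, because the refinement to a subspace produces a system
satisfying them, while the recursive definition of largeness refers to the space as a whole.
\<close>

definition large_system ::
  "('a \<Rightarrow> 'a \<Rightarrow> nat) \<Rightarrow> nat \<Rightarrow> 'a set \<Rightarrow> 'a set \<Rightarrow> (nat \<Rightarrow> 'a set \<Rightarrow> ('a \<Rightarrow> nat) \<Rightarrow> bool) \<Rightarrow> bool" where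
  "large_system d m \<Gamma> E T \<longleftrightarrow>
     (\<forall>s Y g. T s Y g \<longrightarrow> Y \<subseteq> E \<and> level_type d m s Y g) \<and>
     (\<forall>s Y g Y' g'. T s Y g \<and> Y \<subseteq> Y' \<and> Y' \<subseteq> E \<and> level_type d m s Y' g' \<and>
        (\<forall>y\<in>Y. g' y = g y) \<longrightarrow> T s Y' g') \<and>
     (\<forall>s Y g. T (Suc s) Y g \<and> 0 < s \<longrightarrow>
        (\<exists>Y' g'. Y \<subseteq> Y' \<and> (\<forall>y\<in>Y. g' y = g y) \<and> T s Y' g')) \<and>
     (\<forall>Y g. T 1 Y g \<longrightarrow> (\<exists>x\<in>E \<inter> \<Gamma>. \<forall>y\<in>Y. d x y = g y))"

lemma large_systemD:
  assumes "large_system d m \<Gamma> E T"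
  shows "T s Y g \<Longrightarrow> Y \<subseteq> E" "T s Y g \<Longrightarrow> finite Y" "T s Y g \<Longrightarrow> katetov d m Y g"
    "T s Y g \<Longrightarrow> y \<in> Y \<Longrightarrow> s \<le> g y" "T s Y g \<Longrightarrow> \<exists>y\<in>Y. g y = s"
    "T s Y g \<Longrightarrow> Y \<subseteq> Y' \<Longrightarrow> Y' \<subseteq> E \<Longrightarrow> level_type d m s Y' g' \<Longrightarrow>
      (\<And>y. y \<in> Y \<Longrightarrow> g' y = g y) \<Longrightarrow> T s Y' g'"
    "T (Suc s) Y g \<Longrightarrow> 0 < s \<Longrightarrow> \<exists>Y' g'. Y \<subseteq> Y' \<and> (\<forall>y\<in>Y. g' y = g y) \<and> T s Y' g'"
    "T 1 Y g \<Longrightarrow> \<exists>x\<in>E \<inter> \<Gamma>. \<forall>y\<in>Y. d x y = g y"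
proof -
  note sys = assms[unfolded large_system_def]
  note s1 = sys[THEN conjunct1, rule_format] and s2 = sys[THEN conjunct2, THEN conjunct1, rule_format]
    and s3 = sys[THEN conjunct2, THEN conjunct2, THEN conjunct1, rule_format]
    and s4 = sys[THEN conjunct2, THEN conjunct2, THEN conjunct2, rule_format]
  show "T s Y g \<Longrightarrow> Y \<subseteq> E" "T s Y g \<Longrightarrow> finite Y" "T s Y g \<Longrightarrow> katetov d m Y g"
    "T s Y g \<Longrightarrow> y \<in> Y \<Longrightarrow> s \<le> g y" "T s Y g \<Longrightarrow> \<exists>y\<in>Y. g y = s"
    using s1[of s Y g] unfolding level_type_def by simp_all
  show "T s Y g \<Longrightarrow> Y \<subseteq> Y' \<Longrightarrow> Y' \<subseteq> E \<Longrightarrow> level_type d m s Y' g' \<Longrightarrow>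
      (\<And>y. y \<in> Y \<Longrightarrow> g' y = g y) \<Longrightarrow> T s Y' g'"
    by (rule s2[of s Y g]) simp
  show "T (Suc s) Y g \<Longrightarrow> 0 < s \<Longrightarrow> \<exists>Y' g'. Y \<subseteq> Y' \<and> (\<forall>y\<in>Y. g' y = g y) \<and> T s Y' g'"
    by (rule s3) simp
  show "T 1 Y g \<Longrightarrow> \<exists>x\<in>E \<inter> \<Gamma>. \<forall>y\<in>Y. d x y = g y" by (rule s4)
qed

lemma large_system_extend:
  assumes "large_system d m \<Gamma> E T" "T s Y g" "Y \<subseteq> Y'" "Y' \<subseteq> E" "finite Y'" "katetov d m Y' g'"
    "\<And>y. y \<in> Y' \<Longrightarrow> s \<le> g' y" "\<And>y. y \<in> Y \<Longrightarrow> g' y = g y"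
  shows "T s Y' g'"
proof -
  obtain y where "y \<in> Y" "g y = s" using large_systemD(5)[OF assms(1,2)] by blast
  then have "y \<in> Y'" "g' y = s" using assms(3,8) by auto
  then have "level_type d m s Y' g'"
    unfolding level_type_def using assms(5-7) by blast
  then show ?thesis using large_systemD(6)[OF assms(1,2)] assms(3,4,8) by blast
qed

locale urysohn_space = nat_metric +
  assumes countable: "countable X"
    and realise: "finite Y \<Longrightarrow> Y \<subseteq> X \<Longrightarrow> katetov d m Y g \<Longrightarrow> \<exists>e\<in>X. \<forall>y\<in>Y. d e y = g y"

lemma (in nat_metric) katetov_insert:
  assumes Y: "Y \<subseteq> X" and e: "e \<in> X" "e \<notin> Y" and g: "katetov d m Y g" and s: "1 \<le> s" "s \<le> m"
    and c: "\<And>y. y \<in> Y \<Longrightarrow> g y \<le> s + d e y" "\<And>y. y \<in> Y \<Longrightarrow> s \<le> g y + d e y"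
      "\<And>y. y \<in> Y \<Longrightarrow> d e y \<le> g y + s"
  shows "katetov d m (insert e Y) (g(e := s))"
proof -
  have sym: "d y e = d e y" if "y \<in> Y" for y using d_sym e(1) that Y by blast
  have "d e e = 0" using d_zero e by simp
  then show ?thesis
    unfolding katetov_def using katetovD[OF g] s c sym e(2) by (auto simp: add.commute)
qed

lemma (in urysohn_space) realise_new:
  assumes Y: "finite Y" "Y \<subseteq> X" and g: "katetov d m Y g"
  obtains e where "e \<in> X" "e \<notin> Y" "\<And>y. y \<in> Y \<Longrightarrow> d e y = g y"
proof -
  obtain e where e: "e \<in> X" "\<forall>y\<in>Y. d e y = g y" using realise[OF Y g] by blast
  have "e \<notin> Y" using e d_zero katetovD(1)[OF g] by force
  with e show thesis using that by blast
qed

text \<open>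
The raised function is the type of a point that is as far as possible from a realisation of \<open>g\<close>, subject to
lying at distance \<open>s\<close> from it. It is used to give a type the prescribed value \<open>s\<close> at a new point.
\<close>

lemma (in nat_metric) katetov_raise:
  assumes Y: "Y \<subseteq> X" and g: "katetov d m Y g" and s: "1 \<le> s" "s \<le> m"
  shows "katetov d m Y (\<lambda>y. min m (g y + s))"
proof -
  have "d x y \<le> m" if "x \<in> Y" "y \<in> Y" for x y using d_le that Y by blast
  moreover have "g x \<le> g y + d x y" "d x y \<le> g x + g y" if "x \<in> Y" "y \<in> Y" for x y
    using katetovD(3,4)[OF g that] .
  ultimately show ?thesis
    unfolding katetov_def using s by (simp add: min_def) (smt (verit) add.assoc add.commute add_leE add_mono le_add1 le_trans nle_le)
qed

lemma (in urysohn_space) drop_level: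
  assumes Y: "finite Y" "Y \<subseteq> X" and g: "katetov d m Y g" and s: "1 \<le> s" "s \<le> m"
  obtains e where "e \<in> X" "e \<notin> Y" "katetov d m (insert e Y) (g(e := s))"
proof -
  obtain e where e: "e \<in> X" "e \<notin> Y" "\<And>y. y \<in> Y \<Longrightarrow> d e y = min m (g y + s)"
    using realise_new[OF Y katetov_raise[OF Y(2) g s]] by blast
  have "katetov d m (insert e Y) (g(e := s))"
  proof (rule katetov_insert[OF Y(2) e(1,2) g s])
    fix y assume y: "y \<in> Y"
    note * = katetovD(1,2)[OF g y] s e(3)[OF y]
    show "g y \<le> s + d e y" "s \<le> g y + d e y" "d e y \<le> g y + s" using * by linarith+
  qed
  with e show thesis using that by blast
qed

text \<open>
The types \<open>z\<close> in the list \<open>zs\<close> have values above \<open>s z\<close> on \<open>D\<close> and are to be extended, one after the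
other, to large types of level \<open>s z\<close>; each step enlarges \<open>D\<close> by points over which the others are extended by
amalgamation. A type waiting for its turn must keep its values above \<open>s z\<close>. An
extension \<open>l\<close> takes the value \<open>s l\<close> at some new point, and amalgamation then forces upon \<open>z\<close> a value
as small as \<open>a z l + s l\<close>. As \<open>a z l\<close> may be 1, this exceeds \<open>s z\<close> for sure only if \<open>s z \<le> s l\<close>.
Therefore \<open>zs\<close> has to be sorted by decreasing \<open>s\<close>.
\<close>

lemma (in nat_metric) drop_in_turn:
  assumes sys: "large_system d m \<Gamma> X T"
    and a0: "\<And>z. z \<in> Z \<Longrightarrow> a z z = 0"
    and a_sym: "\<And>z z'. z \<in> Z \<Longrightarrow> z' \<in> Z \<Longrightarrow> a z z' = a z' z"
    and a_tri: "\<And>z z' l. z \<in> Z \<Longrightarrow> z' \<in> Z \<Longrightarrow> l \<in> Z \<Longrightarrow> a z l \<le> a z z' + a z' l"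
    and b_le: "\<And>z z'. z \<in> Z \<Longrightarrow> z' \<in> Z \<Longrightarrow> b z z' \<le> m"
    and ab: "\<And>z z' l l'. z \<in> Z \<Longrightarrow> z' \<in> Z \<Longrightarrow> l \<in> Z \<Longrightarrow> l' \<in> Z \<Longrightarrow> b z z' \<le> a z l + b l l' + a z' l'"
    and lv: "\<And>z. z \<in> Z \<Longrightarrow> 1 \<le> lv z \<and> lv z \<le> m"
    and D: "finite D" "D \<subseteq> X" "D0 \<subseteq> D"
    and zs: "distinct zs" "sorted_wrt (\<lambda>z z'. s z' \<le> s z) zs" "set zs \<subseteq> G" "G \<subseteq> Z"
    and s: "\<And>z. z \<in> set zs \<Longrightarrow> lv z = s z \<and> s z + 1 \<le> m \<and> b z z \<le> 2 * s z"
    and apart: "\<And>z l. z \<in> set zs \<Longrightarrow> l \<in> set zs \<Longrightarrow> z \<noteq> l \<Longrightarrow> 1 \<le> a z l"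
    and alv: "\<And>z l. z \<in> Z \<Longrightarrow> l \<in> set zs \<Longrightarrow> lv z \<le> a z l + s l"
    and drop: "\<And>z D'' f''. z \<in> set zs \<Longrightarrow> finite D'' \<Longrightarrow> D0 \<subseteq> D'' \<Longrightarrow> D'' \<subseteq> X \<Longrightarrow>
       (\<forall>x\<in>D0. f'' x = f0 z x) \<Longrightarrow> katetov d m D'' f'' \<Longrightarrow> (\<forall>x\<in>D''. s z + 1 \<le> f'' x) \<Longrightarrow>
       \<exists>D3 q. D'' \<subseteq> D3 \<and> (\<forall>x\<in>D''. q x = f'' x) \<and> T (s z) D3 q"
    and f: "coherent d m D Z a b (\<lambda>z. if z \<in> set zs then s z + 1 else lv z) f"
      "\<And>z x. z \<in> Z \<Longrightarrow> x \<in> D0 \<Longrightarrow> f z x = f0 z x"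
      "\<And>z. z \<in> G \<Longrightarrow> z \<notin> set zs \<Longrightarrow> T (lv z) D (f z)"
  obtains D' f' where "D \<subseteq> D'" "D' \<subseteq> X" "finite D'" "coherent d m D' Z a b lv f'"
    "\<And>z x. z \<in> Z \<Longrightarrow> x \<in> D0 \<Longrightarrow> f' z x = f0 z x" "\<And>z. z \<in> G \<Longrightarrow> T (lv z) D' (f' z)"
proof -
  have "\<exists>D' f'. D \<subseteq> D' \<and> D' \<subseteq> X \<and> finite D' \<and> coherent d m D' Z a b lv f' \<and>
     (\<forall>z\<in>Z. \<forall>x\<in>D0. f' z x = f0 z x) \<and> (\<forall>z\<in>G. T (lv z) D' (f' z))"
    using D zs s apart alv drop f
  proof (induction zs arbitrary: D f)
    case Nil
    then show ?case by (intro exI[of _ D] exI[of _ f]) auto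
  next
    case (Cons l zs)
    let ?lv = "\<lambda>z. if z \<in> set (l # zs) then s z + 1 else lv z"
    let ?lv' = "\<lambda>z. if z \<in> set zs then s z + 1 else lv z"
    note coh = \<open>coherent d m D Z a b ?lv f\<close>
    have l: "l \<in> set (l # zs)" "l \<in> Z" "l \<notin> set zs" "l \<in> G" using Cons.prems(4,6,7) by auto
    have sl: "lv l = s l" "s l + 1 \<le> m" "b l l \<le> 2 * s l" using Cons.prems(8)[OF l(1)] by auto
    have "\<exists>D3 q. D \<subseteq> D3 \<and> (\<forall>x\<in>D. q x = f l x) \<and> T (s l) D3 q"
      using Cons.prems(11)[OF l(1), of D "f l"] Cons.prems(1-3) Cons.prems(13)[OF l(2)]
        coherentD(1,2)[OF coh l(2)] l(1) by simp
    then obtain D3 q where q: "D \<subseteq> D3" "\<And>x. x \<in> D \<Longrightarrow> q x = f l x" "T (s l) D3 q" by blast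
    note qT = large_systemD(1-5)[OF sys q(3)]
    let ?f = "f(l := q)"
    have lv_less: "?lv' z \<le> ?lv z" for z using sl l(3) by auto
    \<comment> \<open>The type \<open>l\<close> has just dropped to \<open>s l\<close>; the types still in \<open>zs\<close> keep the bound \<open>s z + 1\<close>.\<close>
    have c1: "coherent d m D Z a b ?lv' ?f"
    proof -
      have eq: "?f z x = f z x" if "x \<in> D" for z x using q(2)[OF that] by simp
      have "katetov d m D (?f z)" if "z \<in> Z" for z
        using coherentD(1)[OF coh that] katetov_cong[of D "?f z" "f z"] eq by blast
      moreover have "?lv' z \<le> ?f z x" if "z \<in> Z" "x \<in> D" for z x
        using coherentD(2)[OF coh that] lv_less[of z] eq[OF that(2)] by simp
      ultimately show ?thesis
        unfolding coherent_def using coherentD(3,4)[OF coh] eq by simp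
    qed
    have c2: "coherent d m D3 {l} a b ?lv' ?f"
      proof -
      have "b l l \<le> q x + q x" if "x \<in> D3" for x using qT(4)[OF that] sl(3) by simp
      then show ?thesis unfolding coherent_def using qT(3,4) l(3) sl(1) a0[OF l(2)] by simp
    qed
    have alv': "?lv' z \<le> a z k + ?lv' k" if z: "z \<in> Z" and k: "k \<in> {l}" for z k
    proof (cases "z \<in> set zs")
      case True
      then have "z \<noteq> l" using l(3) by auto
      then have "1 \<le> a z l" using Cons.prems(9)[of z l] True by simp
      moreover have "s z \<le> s l" using Cons.prems(5) True by simp
      ultimately show ?thesis using True k l(3) sl(1) by simp
    next
      case False
      then show ?thesis using Cons.prems(10)[OF z l(1)] k l(3) sl(1) by simp
    qed
    have lv': "1 \<le> ?lv' z \<and> ?lv' z \<le> m" if "z \<in> Z" for z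
      using lv[OF that] Cons.prems(8)[of z] by auto
    obtain f' where f': "\<And>z x. z \<in> Z \<Longrightarrow> x \<in> D \<Longrightarrow> f' z x = ?f z x"
        "\<And>z x. z \<in> {l} \<Longrightarrow> x \<in> D3 \<Longrightarrow> f' z x = ?f z x" "coherent d m D3 Z a b ?lv' f'"
    proof (rule amalgamate[OF q(1) qT(1) Cons.prems(1) _ _ c1 c2])
      show "finite {l}" by simp
      show "{l} \<subseteq> Z" using l by simp
      show "a k k = 0" if "k \<in> {l}" for k using a0[of k] l(2) that by simp
      show "b z z' \<le> a z k + b k k' + a z' k'" if "z \<in> Z" "z' \<in> Z" "k \<in> {l}" "k' \<in> {l}" for z z' k k'
        using ab[of z z' k k'] l(2) that by simp
    qed (rule a_sym a_tri b_le lv' alv' that; (assumption | blast))+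
    have T': "T (lv z) D3 (f' z)" if z: "z \<in> G" "z \<notin> set zs" for z
    proof (cases "z = l")
      case True
      have zZ: "z \<in> Z" using z(1) Cons.prems(7) by auto
      show ?thesis unfolding True sl(1)
        by (rule large_system_extend[OF sys q(3) order_refl qT(1,2)])
          (use f' qT(4) coherentD(1)[OF f'(3) l(2)] in auto)
    next
      case False
      have zZ: "z \<in> Z" using z(1) Cons.prems(7) by auto
      have Tz: "T (lv z) D (f z)" using Cons.prems(14)[OF z(1)] z(2) False by simp
      show ?thesis
        by (rule large_system_extend[OF sys Tz q(1) qT(1,2)])
          (use f'(1)[OF zZ] False coherentD(1,2)[OF f'(3) zZ] z(2) in auto)
    qed
    have "\<exists>D' f''. D3 \<subseteq> D' \<and> D' \<subseteq> X \<and> finite D' \<and> coherent d m D' Z a b lv f'' \<and>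
       (\<forall>z\<in>Z. \<forall>x\<in>D0. f'' z x = f0 z x) \<and> (\<forall>z\<in>G. T (lv z) D' (f'' z))"
    proof (rule Cons.IH[OF qT(2) qT(1)])
      show "D0 \<subseteq> D3" using Cons.prems(3) q(1) by blast
      show "distinct zs" "sorted_wrt (\<lambda>z z'. s z' \<le> s z) zs" "set zs \<subseteq> G" "G \<subseteq> Z"
        using Cons.prems by auto
      show "coherent d m D3 Z a b ?lv' f'" by (rule f')
      show "f' z x = f0 z x" if "z \<in> Z" "x \<in> D0" for z x
        using f'(1)[OF that(1), of x] that Cons.prems(3,13) q(2)[of x] by (cases "z = l") auto
      show "T (lv z) D3 (f' z)" if "z \<in> G" "z \<notin> set zs" for z using T'[OF that] .
    qed (use Cons.prems(8-11) in \<open>simp_all\<close>)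
    then obtain D' f'' where *: "D3 \<subseteq> D'" and **: "D' \<subseteq> X \<and> finite D' \<and> coherent d m D' Z a b lv f'' \<and>
       (\<forall>z\<in>Z. \<forall>x\<in>D0. f'' z x = f0 z x) \<and> (\<forall>z\<in>G. T (lv z) D' (f'' z))" by blast
    have "D \<subseteq> D'" using q(1) * by blast
    with ** show ?case by blast
  qed
  then show thesis using that by blast
qed

section \<open>Adding one point to the subspace\<close>

locale refinement = urysohn_space X d m
  for X :: "'a set" and d :: "'a \<Rightarrow> 'a \<Rightarrow> nat" and m :: nat +
  fixes \<Gamma> F :: "'a set" and T :: "nat \<Rightarrow> 'a set \<Rightarrow> ('a \<Rightarrow> nat) \<Rightarrow> bool" and r :: nat
  assumes sys: "large_system d m \<Gamma> X T"
    and r: "1 \<le> r" "Suc r \<le> m"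
    and F: "finite F" "F \<noteq> {}" "F \<subseteq> X"
    and top: "F \<subseteq> V \<Longrightarrow> V \<subseteq> X \<Longrightarrow> level_type d m (Suc r) V g \<Longrightarrow> \<forall>w\<in>F. g w = m \<Longrightarrow> T (Suc r) V g"
begin

lemmas sysD = large_systemD[OF sys]
lemmas sys_extend = large_system_extend[OF sys]

text \<open>
\<open>H\<close> is the set of hats, as functions on \<open>D\<close>. Hats of level below \<open>r\<close> occur as well: they arise when a
hat is extended to a large type of smaller level, as \<open>large_system\<close> demands of the subspace under
construction.
\<close>

definition stage :: "'a set \<Rightarrow> 'a set \<Rightarrow> ('a \<Rightarrow> nat) set \<Rightarrow> bool" where
  "stage Y D H \<longleftrightarrow> finite D \<and> F \<subseteq> Y \<and> Y \<subseteq> D \<and> D \<subseteq> X \<and> finite H \<and>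
     (\<forall>h\<in>H. T (lev Y h) D h \<and> lev Y h \<le> r) \<and>
     (\<forall>h\<in>H. \<forall>h'\<in>H. \<forall>x\<in>D. h x \<le> gap Y h h' + h' x \<and> sep m Y h h' \<le> h x + h' x) \<and>
     (\<forall>g. level_type d m r Y g \<and> (\<forall>w\<in>F. g w = m) \<longrightarrow> (\<exists>h\<in>H. \<forall>y\<in>Y. h y = g y))"

lemma stageD:
  assumes "stage Y D H"
  shows "finite D" "F \<subseteq> Y" "Y \<subseteq> D" "D \<subseteq> X" "finite H" "finite Y" "Y \<noteq> {}" "Y \<subseteq> X"
    "h \<in> H \<Longrightarrow> T (lev Y h) D h" "h \<in> H \<Longrightarrow> lev Y h \<le> r"
    "h \<in> H \<Longrightarrow> h' \<in> H \<Longrightarrow> x \<in> D \<Longrightarrow> h x \<le> gap Y h h' + h' x"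
    "h \<in> H \<Longrightarrow> h' \<in> H \<Longrightarrow> x \<in> D \<Longrightarrow> sep m Y h h' \<le> h x + h' x"
    "level_type d m r Y g \<Longrightarrow> \<forall>w\<in>F. g w = m \<Longrightarrow> \<exists>h\<in>H. \<forall>y\<in>Y. h y = g y"
proof -
  note st = assms[unfolded stage_def]
  show fin: "finite D" and FY: "F \<subseteq> Y" and YD: "Y \<subseteq> D" and DX: "D \<subseteq> X" and "finite H" using st by simp_all
  show "finite Y" using fin YD by (rule rev_finite_subset)
  show "Y \<noteq> {}" using F(2) FY by blast
  show "Y \<subseteq> X" using YD DX by (rule order_trans)
  show "h \<in> H \<Longrightarrow> T (lev Y h) D h" "h \<in> H \<Longrightarrow> lev Y h \<le> r" using st by simp_all
  show "h \<in> H \<Longrightarrow> h' \<in> H \<Longrightarrow> x \<in> D \<Longrightarrow> h x \<le> gap Y h h' + h' x"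
    "h \<in> H \<Longrightarrow> h' \<in> H \<Longrightarrow> x \<in> D \<Longrightarrow> sep m Y h h' \<le> h x + h' x" using st by simp_all
  show "level_type d m r Y g \<Longrightarrow> \<forall>w\<in>F. g w = m \<Longrightarrow> \<exists>h\<in>H. \<forall>y\<in>Y. h y = g y" using st by simp
qed

text \<open>
No hat is needed at the beginning, since the only type over \<open>F\<close> to be considered is constantly \<open>m > r\<close>.
\<close>

lemma stage_start: "stage F F {}"
proof -
  have "\<not> level_type d m r F g" if "\<forall>w\<in>F. g w = m" for g
    using that r unfolding level_type_def by force
  then show ?thesis unfolding stage_def using F by blast
qed

text \<open>
The extension to \<open>D\<close> leaves every distance from the new point to a formal point under a hat possible
that is possible over \<open>Y\<close>. In particular the extension agrees with a hat if \<open>t\<close> agrees with it on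
\<open>Y\<close>, so that the point realising it can be taken from \<open>\<Gamma>\<close> if that hat has level 1.
\<close>

lemma stage_point:
  assumes st: "stage Y D H" and t: "katetov d m Y t"
  obtains u where "katetov d m D u" "\<And>y. y \<in> Y \<Longrightarrow> u y = t y"
    "\<And>h x. h \<in> H \<Longrightarrow> x \<in> D \<Longrightarrow> u x \<le> gap Y t h + h x"
    "\<And>h x. h \<in> H \<Longrightarrow> x \<in> D \<Longrightarrow> h x \<le> gap Y t h + u x"
    "\<And>h x. h \<in> H \<Longrightarrow> x \<in> D \<Longrightarrow> sep m Y t h \<le> u x + h x"
proof -
  note S = stageD[OF st]
  note fin = S(6) and ne = S(7)
  have kH: "katetov d m D h" if "h \<in> H" for h using sysD(3)[OF S(9)[OF that]] .
  let ?Z = "insert t H"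
  have kZ: "katetov d m Y z" if "z \<in> ?Z" for z
    using that t katetov_mono[OF kH S(3)] by blast
  have c1: "coherent d m Y ?Z (gap Y) (sep m Y) (lev Y) (\<lambda>z. z)"
    unfolding coherent_def by (intro conjI ballI kZ lev_le[OF fin] gap_ge[OF fin] sep_le[OF fin])
  have c2: "coherent d m D H (gap Y) (sep m Y) (lev Y) (\<lambda>z. z)"
    unfolding coherent_def by (intro conjI ballI kH sysD(4)[OF S(9)] S(11,12))
  have lv: "1 \<le> lev Y z \<and> lev Y z \<le> m" if z: "z \<in> ?Z" for z
  proof -
    obtain y where "y \<in> Y" "z y = lev Y z" using lev_attained[OF fin ne] .
    then show ?thesis using katetovD(1,2)[OF kZ[OF z], of y] by simp
  qed
  obtain f' where f': "\<And>z x. z \<in> ?Z \<Longrightarrow> x \<in> Y \<Longrightarrow> f' z x = z x"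
      "\<And>z x. z \<in> H \<Longrightarrow> x \<in> D \<Longrightarrow> f' z x = z x" "coherent d m D ?Z (gap Y) (sep m Y) (lev Y) f'"
  proof (rule amalgamate[OF S(3,4) fin S(5) subset_insertI c1 c2])
    show "gap Y l l = 0" for l using gap_refl[OF fin ne] .
    show "gap Y z z' = gap Y z' z" for z z' using gap_sym .
    show "gap Y z l \<le> gap Y z z' + gap Y z' l" for z z' l using gap_triangle[OF fin ne] .
    show "sep m Y z z' \<le> m" for z z' using sep_le_m[OF fin] .
    show "sep m Y z z' \<le> gap Y z l + sep m Y l l' + gap Y z' l'" for z z' l l'
      using sep_gap[OF fin ne] .
    show "lev Y z \<le> gap Y z l + lev Y l" for z l using lev_gap[OF fin ne] .
  qed (rule lv that; (assumption | blast))+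
  show thesis
  proof (rule that[of "f' t"])
    show "katetov d m D (f' t)" using coherentD(1)[OF f'(3)] by blast
    show "f' t y = t y" if "y \<in> Y" for y using f'(1) that by blast
    fix h x assume h: "h \<in> H" "x \<in> D"
    note * = coherentD(3,4)[OF f'(3) _ _ h(2)]
    show "f' t x \<le> gap Y t h + h x" using *(1)[of t h] f'(2)[OF h] h(1) by simp
    show "h x \<le> gap Y t h + f' t x" using *(1)[of h t] f'(2)[OF h] h(1) gap_sym[of Y t h] by simp
    show "sep m Y t h \<le> f' t x + h x" using *(2)[of t h] f'(2)[OF h] h(1) by simp
  qed
qed

text \<open>
The new point \<open>e\<close> of type \<open>t\<close> over \<open>Y\<close> is first treated as a formal point. A dummy point \<open>e0\<close> of the space
with the same type over \<open>Y\<close> lets the types over \<open>insert e Y\<close> be written as functions on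
\<open>P = insert e0 Y\<close>; the function \<open>\<epsilon> = d e0\<close> stands for \<open>e\<close> itself. The formal points
are \<open>\<epsilon>\<close>, the types in \<open>ZA\<close> that extend an old hat (restricted to \<open>Y\<close>) and lower its level by at most one, and the
types in \<open>ZN\<close>, whose level \<open>r\<close> is attained only at \<open>e\<close>. Those in \<open>U\<close> attain their level only at
\<open>e\<close>, so that their values on \<open>D\<close> are still one too large and \<open>drop_in_turn\<close> has to supply their hats.
The point \<open>e\<close> is realised at the end, with the distances to the enlarged set \<open>D'\<close> that the formal
point \<open>\<epsilon>\<close> has by then.

Allowing the level to drop by one is what makes the system of large types of the subspace closed under
passing to smaller levels.
\<close>

lemma stage_step:
  assumes st: "stage Y D H" and t: "katetov d m Y t"
  obtains e D' H' where "e \<in> X" "e \<notin> Y" "\<And>y. y \<in> Y \<Longrightarrow> d e y = t y" "stage (insert e Y) D' H'"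
    "\<And>h g. h \<in> H \<Longrightarrow> katetov d m (insert e Y) g \<Longrightarrow> \<forall>y\<in>Y. g y = h y \<Longrightarrow> lev Y h \<le> g e + 1 \<Longrightarrow>
        \<exists>h'\<in>H'. \<forall>y\<in>insert e Y. h' y = g y"
    "\<And>h. h \<in> H \<Longrightarrow> lev Y h = 1 \<Longrightarrow> \<forall>y\<in>Y. h y = t y \<Longrightarrow> e \<in> \<Gamma>"
proof -
  note S = stageD[OF st]
  have YX: "y \<in> X" if "y \<in> Y" for y using S(8) that by blast
  have kH: "katetov d m D h" if "h \<in> H" for h using sysD(3)[OF S(9)[OF that]] .
  obtain u where u: "katetov d m D u" "\<And>y. y \<in> Y \<Longrightarrow> u y = t y"
    "\<And>h x. h \<in> H \<Longrightarrow> x \<in> D \<Longrightarrow> u x \<le> gap Y t h + h x"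
    "\<And>h x. h \<in> H \<Longrightarrow> x \<in> D \<Longrightarrow> h x \<le> gap Y t h + u x"
    "\<And>h x. h \<in> H \<Longrightarrow> x \<in> D \<Longrightarrow> sep m Y t h \<le> u x + h x"
    by (rule stage_point[OF st t]) blast
  obtain e0 where e0: "e0 \<in> X" "e0 \<notin> Y" "\<And>y. y \<in> Y \<Longrightarrow> d e0 y = t y"
    by (rule realise_new[OF S(6,8) t]) blast
  have e00: "d e0 e0 = 0" using d_zero e0 by simp
  define P where "P = insert e0 Y"
  have P: "finite P" "P \<noteq> {}" "Y \<subseteq> P" "e0 \<in> P" unfolding P_def using S(6) by auto
  define \<epsilon> where "\<epsilon> = d e0"
  have \<epsilon>: "\<epsilon> e0 = 0" "\<And>y. y \<in> Y \<Longrightarrow> \<epsilon> y = t y" unfolding \<epsilon>_def using e00 e0 by auto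
  define Ext where "Ext = (P \<rightarrow>\<^sub>E {..m})"
  define ZA where "ZA = {z \<in> Ext. katetov d m P z \<and> (\<exists>h\<in>H. (\<forall>y\<in>Y. z y = h y) \<and> lev Y h \<le> z e0 + 1)}"
  define ZN where "ZN = {z \<in> Ext. katetov d m P z \<and> z e0 = r \<and> (\<forall>y\<in>Y. r + 1 \<le> z y) \<and> (\<forall>w\<in>F. z w = m)}"
  define L where "L = insert \<epsilon> ZA"
  define Z where "Z = L \<union> ZN"
  define U where "U = {z \<in> ZA \<union> ZN. \<forall>y\<in>Y. z e0 < z y}"
  define hat where "hat z = (SOME h. h \<in> H \<and> (\<forall>y\<in>Y. h y = z y))" for z :: "'a \<Rightarrow> nat"
  define f where "f z = (if z = \<epsilon> then u else if z \<in> ZA then hat z else z)" for z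
  \<comment> \<open>The level 1 of \<open>\<epsilon>\<close> expresses that \<open>e\<close> must differ from all points of \<open>D\<close>, although \<open>\<epsilon>\<close> vanishes
  at \<open>e0\<close>. For types in \<open>U\<close> the bound on \<open>D\<close> is \<open>lv0\<close> before and \<open>lv\<close> after they are processed.\<close>
  define lv where "lv z = (if z = \<epsilon> then 1 else lev P z)" for z
  define lv0 where "lv0 z = (if z \<in> U then z e0 + 1 else lv z)" for z
  have finExt: "finite Ext" unfolding Ext_def using P by (intro finite_PiE) auto
  have finA: "finite ZA" "finite ZN" unfolding ZA_def ZN_def using finExt by auto
  then have finL: "finite L" "finite Z" "finite U" unfolding L_def Z_def U_def by auto
  have kZ: "katetov d m P z" if "z \<in> ZA \<union> ZN" for z using that unfolding ZA_def ZN_def by auto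
  have pos: "1 \<le> z e0" if "z \<in> ZA \<union> ZN" for z using katetovD(1)[OF kZ[OF that] P(4)] .
  have n\<epsilon>: "z \<noteq> \<epsilon>" if "z \<in> ZA \<union> ZN" for z using pos[OF that] \<epsilon>(1) by auto
  have hat: "hat z \<in> H" "\<And>y. y \<in> Y \<Longrightarrow> hat z y = z y" "lev Y (hat z) = lev Y z"
      "lev Y z \<le> z e0 + 1" "lev Y z \<le> r" if z: "z \<in> ZA" for z
  proof -
    obtain h where h: "h \<in> H" "\<And>y. y \<in> Y \<Longrightarrow> z y = h y" "lev Y h \<le> z e0 + 1"
      using z unfolding ZA_def by blast
    have "\<exists>h. h \<in> H \<and> (\<forall>y\<in>Y. h y = z y)" using h by (intro exI[of _ h]) simp
    then have *: "hat z \<in> H \<and> (\<forall>y\<in>Y. hat z y = z y)" unfolding hat_def by (rule someI_ex)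
    then show "hat z \<in> H" "\<And>y. y \<in> Y \<Longrightarrow> hat z y = z y" by auto
    show **: "lev Y (hat z) = lev Y z" using * by (intro lev_cong) blast
    show "lev Y z \<le> z e0 + 1" using h(3) lev_cong[of Y z h] h(2) by simp
    show "lev Y z \<le> r" using S(10)[of "hat z"] * ** by simp
  qed
  have NU: "z \<in> U" if "z \<in> ZN" for z using that unfolding U_def ZN_def by fastforce
  have fY: "f z y = z y" if "z \<in> Z" "y \<in> Y" for z y
    using that hat(2) u(2) \<epsilon>(2) unfolding f_def by auto
  have levP: "lev P z \<le> z p" if "p \<in> P" for z p using lev_le[OF P(1) that] .
  have lv0_le: "lv0 z \<le> z y" if z: "z \<in> Z" and y: "y \<in> Y" for z y
  proof -
    have "1 \<le> t y" using katetovD(1)[OF t y] .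
    then show ?thesis using levP[of y z] y P(3) \<epsilon>(2)[OF y] unfolding lv0_def lv_def U_def by force
  qed
  have lv0_e: "lv0 z \<le> z e0 + 1" for z
    using levP[OF P(4), of z] \<epsilon>(1) unfolding lv0_def lv_def by auto
  have lv_e: "z \<noteq> \<epsilon> \<Longrightarrow> lv z \<le> z e0" for z
    using levP[OF P(4), of z] unfolding lv_def by auto
  have lvU: "lv z = z e0" if z: "z \<in> U" for z
  proof -
    have "lev P z = z e0"
      using that P_def by (intro lev_eqI[OF P(1,4)]) (auto simp: U_def)
    then show ?thesis using n\<epsilon>[of z] z unfolding lv_def U_def by auto
  qed
  have levA: "lev P z = lev Y z" if z: "z \<in> ZA" "z \<notin> U" for z
  proof -
    obtain y where y: "y \<in> Y" "z y \<le> z e0" using z unfolding U_def by force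
    obtain y' where y': "y' \<in> Y" "z y' = lev Y z" using lev_attained[OF S(6,7)] .
    have "lev Y z \<le> z q" if "q \<in> P" for q
    proof (cases "q = e0")
      case True then show ?thesis using lev_le[OF S(6) y(1), of z] y(2) by simp
    next
      case False then show ?thesis using lev_le[OF S(6), of q z] that unfolding P_def by simp
    qed
    then show ?thesis using y' P(3) by (intro lev_eqI[OF P(1), of y']) auto
  qed
  have lv0A: "lv0 z = lev Y z" if z: "z \<in> ZA" for z
  proof (cases "z \<in> U")
    case True
    obtain y' where y': "y' \<in> Y" "z y' = lev Y z" using lev_attained[OF S(6,7)] .
    then show ?thesis using True hat(4)[OF z] unfolding lv0_def U_def by fastforce
  next
    case False
    then show ?thesis using levA[OF z] n\<epsilon>[of z] z unfolding lv0_def lv_def by simp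
  qed
  have lv_m: "1 \<le> lv z \<and> lv z \<le> m" if z: "z \<in> Z" for z
  proof (cases "z = \<epsilon>")
    case True then show ?thesis using r unfolding lv_def by simp
  next
    case False
    then have k: "katetov d m P z" using z kZ unfolding Z_def L_def by blast
    obtain p where "p \<in> P" "z p = lev P z" using lev_attained[OF P(1,2)] .
    then show ?thesis using katetovD(1,2)[OF k, of p] False unfolding lv_def by simp
  qed
  have Ue: "z e0 + 1 \<le> m" if z: "z \<in> U" for z
  proof -
    obtain y where y: "y \<in> Y" using S(7) by blast
    have "z e0 < z y" using z y unfolding U_def by blast
    moreover have "z y \<le> m" using katetovD(2)[OF kZ, of z y] z y P(3) unfolding U_def by blast
    ultimately show ?thesis by simp
  qed
  have lv0_m: "1 \<le> lv0 z \<and> lv0 z \<le> m" if z: "z \<in> Z" for z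
    using lv_m[OF z] Ue[of z] unfolding lv0_def by simp
  have kY: "katetov d m Y z" if "z \<in> Z" for z
  proof (cases "z = \<epsilon>")
    case True then show ?thesis using t katetov_cong[of Y \<epsilon> t] \<epsilon>(2) by blast
  next
    case False then show ?thesis
      using katetov_mono[OF kZ P(3)] that unfolding Z_def L_def by blast
  qed
  note gapP = gap_ge[OF P(1)] and sepP = sep_le[OF P(1)]
  have c1: "coherent d m Y Z (gap P) (sep m P) lv0 f"
    unfolding coherent_def
  proof (intro conjI ballI)
    fix z assume z: "z \<in> Z"
    show "katetov d m Y (f z)" using kY[OF z] katetov_cong[of Y "f z" z] fY[OF z] by blast
    fix x assume x: "x \<in> Y"
    show "lv0 z \<le> f z x" using lv0_le[OF z x] fY[OF z x] by simp
  next
    fix z z' x assume z: "z \<in> Z" "z' \<in> Z" and x: "x \<in> Y"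
    have xP: "x \<in> P" using x P by blast
    show "f z x \<le> gap P z z' + f z' x" "sep m P z z' \<le> f z x + f z' x"
      using gapP[OF xP, of z z'] sepP[OF xP, of m z z'] fY[OF z(1) x] fY[OF z(2) x] by simp_all
  qed
  have gapm: "gap Y z z' \<le> gap P z z'" for z z' using gap_mono[OF P(1,3) S(7)] .
  have sepm: "sep m P z z' \<le> sep m Y z z'" for z z' using sep_antimono[OF P(1,3)] .
  have f\<epsilon>: "f \<epsilon> = u" unfolding f_def by simp
  have fA: "f z = hat z" if "z \<in> ZA" for z using that n\<epsilon>[of z] unfolding f_def by simp
  \<comment> \<open>On \<open>D\<close> the bounds hold even with \<open>Y\<close> in place of \<open>P\<close>, which is stronger.\<close>
  have c2: "coherent d m D L (gap P) (sep m P) lv0 f"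
    unfolding coherent_def
  proof (intro conjI ballI)
    fix z assume z: "z \<in> L"
    show "katetov d m D (f z)"
      using z u(1) kH[OF hat(1)] f\<epsilon> fA unfolding L_def by auto
    fix x assume x: "x \<in> D"
    show "lv0 z \<le> f z x"
    proof (cases "z = \<epsilon>")
      case True
      then show ?thesis using katetovD(1)[OF u(1) x] f\<epsilon> \<epsilon>(1) lv0_e[of \<epsilon>] by simp
    next
      case False
      then have "z \<in> ZA" using z unfolding L_def by simp
      then show ?thesis
        using sysD(4)[OF S(9)[OF hat(1)] x] hat(3) lv0A fA by simp
    qed
  next
    fix z z' x assume z: "z \<in> L" "z' \<in> L" and x: "x \<in> D"
    have t\<epsilon>: "gap Y t h = gap Y \<epsilon> h'" "sep m Y t h = sep m Y \<epsilon> h'" if "\<And>y. y \<in> Y \<Longrightarrow> h y = h' y" for h h'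
      using that \<epsilon>(2) by (intro gap_cong sep_cong; simp)+
    have e1: "u x \<le> gap P \<epsilon> z + hat z x" "hat z x \<le> gap P \<epsilon> z + u x" "sep m P \<epsilon> z \<le> u x + hat z x"
      if "z \<in> ZA" for z
      using u(3-5)[OF hat(1)[OF that] x] t\<epsilon>[of "hat z" z, OF hat(2)[OF that]] gapm[of \<epsilon> z] sepm[of \<epsilon> z] by linarith+
    have e2: "hat z x \<le> gap P z z' + hat z' x" "sep m P z z' \<le> hat z x + hat z' x"
      if z: "z \<in> ZA" "z' \<in> ZA" for z z'
    proof -
      have "gap Y (hat z) (hat z') = gap Y z z'" "sep m Y (hat z) (hat z') = sep m Y z z'"
        using hat(2)[OF z(1)] hat(2)[OF z(2)] by (intro gap_cong sep_cong; simp)+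
      then show "hat z x \<le> gap P z z' + hat z' x" "sep m P z z' \<le> hat z x + hat z' x"
        using S(11,12)[OF hat(1)[OF z(1)] hat(1)[OF z(2)] x] gapm[of z z'] sepm[of z z'] by linarith+
    qed
    have e3: "sep m P \<epsilon> \<epsilon> \<le> u x + u x" using sepP[OF P(4), of m \<epsilon> \<epsilon>] \<epsilon>(1) by simp
    have sym: "sep m P z \<epsilon> = sep m P \<epsilon> z" for z unfolding sep_def by (simp add: add.commute)
    consider "z = \<epsilon>" "z' = \<epsilon>" | "z = \<epsilon>" "z' \<in> ZA" | "z \<in> ZA" "z' = \<epsilon>" | "z \<in> ZA" "z' \<in> ZA"
      using z unfolding L_def by blast
    then have "f z x \<le> gap P z z' + f z' x \<and> sep m P z z' \<le> f z x + f z' x"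
    proof cases
      case 1 then show ?thesis using e3 f\<epsilon> by simp
    next
      case 2 then show ?thesis using e1(1,3)[of z'] f\<epsilon> fA[of z'] by simp
    next
      case 3 then show ?thesis
        using e1(2,3)[of z] f\<epsilon> fA[of z] gap_sym[of P \<epsilon> z] sym[of z] by (simp add: add.commute)
    next
      case 4 then show ?thesis using e2[of z z'] fA[of z] fA[of z'] by simp
    qed
    then show "f z x \<le> gap P z z' + f z' x" "sep m P z z' \<le> f z x + f z' x" by blast+
  qed
  have alv0: "lv0 z \<le> gap P z l + lv0 l" if z: "z \<in> Z" and l: "l \<in> L" for z l
  proof (cases "l = \<epsilon>")
    case True
    have "z e0 \<le> gap P z \<epsilon>" using gapP[OF P(4), of z \<epsilon>] \<epsilon>(1) by simp
    moreover have "lv0 \<epsilon> = 1" using n\<epsilon>[of \<epsilon>] unfolding lv0_def lv_def U_def by auto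
    ultimately show ?thesis using lv0_e[of z] True by simp
  next
    case False
    then have "l \<in> ZA" using l unfolding L_def by simp
    moreover obtain y where y: "y \<in> Y" "l y = lev Y l" using lev_attained[OF S(6,7)] .
    ultimately have "lv0 l = l y" using lv0A by simp
    then show ?thesis using lv0_le[OF z y(1)] gapP[of y z l] y(1) P(3) by fastforce
  qed
  note aP = gap_refl[OF P(1,2)] gap_sym[of P] gap_triangle[OF P(1,2)] sep_le_m[OF P(1)]
    sep_gap[OF P(1,2)]
  have LZ: "L \<subseteq> Z" unfolding Z_def by blast
  obtain f1 where f1: "\<And>z x. z \<in> Z \<Longrightarrow> x \<in> Y \<Longrightarrow> f1 z x = f z x"
      "\<And>z x. z \<in> L \<Longrightarrow> x \<in> D \<Longrightarrow> f1 z x = f z x" "coherent d m D Z (gap P) (sep m P) lv0 f1"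
    by (rule amalgamate[OF S(3,4,6) finL(1) LZ c1 c2 aP lv0_m alv0]) (assumption | (rule that; assumption))+
  \<comment> \<open>The keys are subtracted from \<open>m\<close> because \<open>drop_in_turn\<close> needs a decreasing order.\<close>
  obtain xs where xs: "set xs = U" "distinct xs" using finite_distinct_list[OF finL(3)] by blast
  define zs where "zs = sort_key (\<lambda>z. m - z e0) xs"
  have zs: "set zs = U" "distinct zs" unfolding zs_def using xs by auto
  have "sorted_wrt (\<lambda>z z'. m - z e0 \<le> m - z' e0) zs"
    unfolding zs_def using sorted_sort_key[of "\<lambda>z. m - z e0" xs] by (simp add: sorted_map)
  then have zs_sorted: "sorted_wrt (\<lambda>z z'. z' e0 \<le> z e0) zs"
  proof (rule sorted_wrt_mono_rel[rotated])
    fix z z' assume "z \<in> set zs" "z' \<in> set zs" and le: "m - z e0 \<le> m - z' e0"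
    then have "z e0 + 1 \<le> m" "z' e0 + 1 \<le> m" using Ue zs by auto
    then show "z' e0 \<le> z e0" using le by simp
  qed
  \<comment> \<open>If \<open>u\<close> is large of level 1, then it stays so as \<open>D\<close> grows, and \<open>e\<close> can be found in \<open>\<Gamma>\<close>.\<close>
  define G where "G = (if T 1 D u then Z else Z - {\<epsilon>})"
  have GZ: "G \<subseteq> Z" "U \<subseteq> G" unfolding G_def U_def Z_def L_def using n\<epsilon> by auto
  have drop: "\<exists>D3 q. D'' \<subseteq> D3 \<and> (\<forall>x\<in>D''. q x = f'' x) \<and> T (z e0) D3 q"
    if z: "z \<in> U" and D'': "finite D''" "D \<subseteq> D''" "D'' \<subseteq> X" "\<forall>x\<in>D. f'' x = f1 z x"
      and k: "katetov d m D'' f''" "\<forall>x\<in>D''. z e0 + 1 \<le> f'' x" for z D'' f''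
  proof (cases "z \<in> ZA")
    case True
    then have zL: "z \<in> L" unfolding L_def by simp
    have "lev Y (hat z) = Suc (z e0)" using hat(3)[OF True] lv0A[OF True] z unfolding lv0_def by simp
    then have T1: "T (Suc (z e0)) D (hat z)" using S(9)[OF hat(1)[OF True]] by simp
    have "T (Suc (z e0)) D'' f''"
      by (rule sys_extend[OF T1 D''(2,3,1) k(1)])
        (use k(2) D''(4) f1(2)[OF zL] fA[OF True] in auto)
    then show ?thesis using sysD(7) pos[of z] True by auto
  next
    case False
    then have zN: "z \<in> ZN" using z unfolding U_def by blast
    then have ze: "z e0 = r" unfolding ZN_def by blast
    have "1 \<le> Suc r" by simp
    \<comment> \<open>The values of \<open>f''\<close> are above \<open>r\<close>, but \<open>r + 1\<close> need not be among them; a further point makes the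
    level exactly \<open>r + 1\<close>, as \<open>top\<close> requires.\<close>
    obtain e where e: "e \<in> X" "e \<notin> D''" "katetov d m (insert e D'') (f''(e := Suc r))"
      using drop_level[OF D''(1,3) k(1) \<open>1 \<le> Suc r\<close> r(2)] .
    have "T (Suc r) (insert e D'') (f''(e := Suc r))"
    proof (rule top)
      show "F \<subseteq> insert e D''" using S(2,3) D''(2) by blast
      show "insert e D'' \<subseteq> X" using e(1) D''(3) by blast
      show "level_type d m (Suc r) (insert e D'') (f''(e := Suc r))"
        unfolding level_type_def using D''(1) e(2,3) k(2) ze by auto
      show "\<forall>w\<in>F. (f''(e := Suc r)) w = m"
      proof
        fix w assume w: "w \<in> F"
        then have wY: "w \<in> Y" "w \<in> D" "w \<in> D''" using S(2,3) D''(2) by auto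
        have zZ: "z \<in> Z" using zN unfolding Z_def by simp
        have "f'' w = z w" using D''(4) wY f1(1)[OF zZ wY(1)] fY[OF zZ wY(1)] by simp
        then show "(f''(e := Suc r)) w = m" using zN w wY e(2) unfolding ZN_def by auto
      qed
    qed
    then obtain D3 q where q: "insert e D'' \<subseteq> D3" "\<forall>x\<in>insert e D''. q x = (f''(e := Suc r)) x" "T r D3 q"
      using sysD(7) r(1) by (metis less_eq_Suc_le One_nat_def)
    then show ?thesis using e(2) ze by (intro exI[of _ D3] exI[of _ q]) auto
  qed
  have T1: "T (lv z) D (f1 z)" if z: "z \<in> G" "z \<notin> U" for z
  proof (cases "z = \<epsilon>")
    case True
    then have T: "T 1 D u" using z(1) unfolding G_def by (auto split: if_splits)
    have "T 1 D (f1 z)"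
    proof (rule sys_extend[OF T order_refl S(4,1)])
      have eq: "f1 z x = u x" if "x \<in> D" for x using f1(2)[of z x] that f\<epsilon> True unfolding L_def by simp
      show "katetov d m D (f1 z)" using u(1) katetov_cong[of D "f1 z" u d m] eq by blast
      show "1 \<le> f1 z x" if "x \<in> D" for x using katetovD(1)[OF u(1) that] eq[OF that] by simp
      show "f1 z x = u x" if "x \<in> D" for x using eq[OF that] .
    qed
    then show ?thesis using True unfolding lv_def by simp
  next
    case False
    then have zA: "z \<in> ZA" using z GZ NU unfolding Z_def L_def by blast
    have eq: "f1 z x = hat z x" if "x \<in> D" for x using f1(2)[of z x] fA[OF zA] zA that unfolding L_def by simp
    have T: "T (lv z) D (hat z)"
      using S(9)[OF hat(1)[OF zA]] hat(3)[OF zA] levA[OF zA z(2)] False unfolding lv_def by simp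
    show ?thesis
    proof (rule sys_extend[OF T order_refl S(4,1)])
      show "katetov d m D (f1 z)"
        using sysD(3)[OF T] katetov_cong[of D "f1 z" "hat z" d m] eq by blast
      show "lv z \<le> f1 z x" if "x \<in> D" for x using sysD(4)[OF T that] eq[OF that] by simp
      show "f1 z x = hat z x" if "x \<in> D" for x using eq[OF that] .
    qed
  qed
  obtain D' f2 where f2: "D \<subseteq> D'" "D' \<subseteq> X" "finite D'" "coherent d m D' Z (gap P) (sep m P) lv f2"
    "\<And>z x. z \<in> Z \<Longrightarrow> x \<in> D \<Longrightarrow> f2 z x = f1 z x" "\<And>z. z \<in> G \<Longrightarrow> T (lv z) D' (f2 z)"
  proof (rule drop_in_turn[where s = "\<lambda>z. z e0" and f = f1 and ?f0.0 = f1 and G = G and Z = Z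
        and lv = lv and T = T, OF sys aP lv_m S(1,4) order_refl zs(2) zs_sorted])
    show "set zs \<subseteq> G" "G \<subseteq> Z" using GZ zs(1) by auto
    show "lv z = z e0 \<and> z e0 + 1 \<le> m \<and> sep m P z z \<le> 2 * z e0" if "z \<in> set zs" for z
      using lvU[of z] Ue[of z] sepP[OF P(4), of m z z] that zs(1) by simp
    show "1 \<le> gap P z l" if "z \<in> set zs" "l \<in> set zs" "z \<noteq> l" for z l
    proof (rule ccontr)
      assume "\<not> 1 \<le> gap P z l"
      then have "z p = l p" if "p \<in> P" for p
        using gapP[OF that, of z l] gapP[OF that, of l z] gap_sym[of P l z] by simp
      moreover have "z \<in> Ext" "l \<in> Ext" using that zs(1) unfolding U_def ZA_def ZN_def by auto
      ultimately have "z = l" unfolding Ext_def by (intro PiE_ext)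
      then show False using that by simp
    qed
    show "lv z \<le> gap P z l + l e0" if z: "z \<in> Z" and l: "l \<in> set zs" for z l
    proof (cases "z = \<epsilon>")
      case True then show ?thesis using pos[of l] l zs(1) unfolding U_def lv_def by auto
    next
      case False then show ?thesis using lv_e[OF False] gapP[OF P(4), of z l] by simp
    qed
    show "coherent d m D Z (gap P) (sep m P) (\<lambda>z. if z \<in> set zs then z e0 + 1 else lv z) f1"
      using f1(3) unfolding zs(1) lv0_def .
    show "\<exists>D3 q. D'' \<subseteq> D3 \<and> (\<forall>x\<in>D''. q x = f'' x) \<and> T (z e0) D3 q"
      if "z \<in> set zs" "finite D''" "D \<subseteq> D''" "D'' \<subseteq> X" "\<forall>x\<in>D. f'' x = f1 z x"
        "katetov d m D'' f''" "\<forall>x\<in>D''. z e0 + 1 \<le> f'' x" for z D'' f''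
      using drop[of z D'' f''] that zs(1) by simp
    show "T (lv z) D (f1 z)" if "z \<in> G" "z \<notin> set zs" for z using T1[OF that(1)] that(2) zs(1) by simp
  qed (assumption | rule refl | (rule that; assumption))+
  have \<epsilon>Z: "\<epsilon> \<in> Z" unfolding Z_def L_def by simp
  have f2Y: "f2 z y = z y" if "z \<in> Z" "y \<in> Y" for z y
    using f2(5)[OF that(1)] f1(1)[OF that] fY[OF that] that(2) S(3) by auto
  let ?v = "f2 \<epsilon>"
  have kv: "katetov d m D' ?v" using coherentD(1)[OF f2(4) \<epsilon>Z] .
  obtain e where e: "e \<in> X" "e \<notin> D'" "\<And>x. x \<in> D' \<Longrightarrow> d e x = ?v x" "T 1 D' ?v \<Longrightarrow> e \<in> \<Gamma>"
  proof -
    obtain e where e: "e \<in> X" "\<And>x. x \<in> D' \<Longrightarrow> d e x = ?v x" "T 1 D' ?v \<Longrightarrow> e \<in> \<Gamma>"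
    proof (cases "T 1 D' ?v")
      case True
      then show thesis using that sysD(8)[OF True] by blast
    next
      case False
      then show thesis using that realise[OF f2(3,2) kv] by blast
    qed
    moreover have "e \<notin> D'" using e(1,2) d_zero katetovD(1)[OF kv] by force
    ultimately show thesis using that by blast
  qed
  have YD': "Y \<subseteq> D'" using S(3) f2(1) by blast
  have eY: "e \<notin> Y" using e(2) YD' by blast
  have de: "d e y = t y" if "y \<in> Y" for y using e(3)[of y] f2Y[OF \<epsilon>Z that] \<epsilon>(2)[OF that] that YD' by auto
  define lift where "lift z = (f2 z)(e := z e0)" for z
  define H' where "H' = lift ` (ZA \<union> ZN)"
  have liftY: "lift z y = z y" if "z \<in> ZA \<union> ZN" "y \<in> Y" for z y
    using f2Y[of z y] that eY unfolding lift_def Z_def L_def by auto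
  have lifte: "lift z e = z e0" for z unfolding lift_def by simp
  have liftD: "lift z x = f2 z x" if "x \<in> D'" for z x using that e(2) unfolding lift_def by auto
  have tr1: "lev (insert e Y) (lift z) = lev P z" if "z \<in> ZA \<union> ZN" for z
    unfolding lev_def P_def using liftY[OF that] lifte by (simp cong: image_cong)
  have tr2: "gap (insert e Y) (lift z) (lift z') = gap P z z'" "sep m (insert e Y) (lift z) (lift z') = sep m P z z'"
    if "z \<in> ZA \<union> ZN" "z' \<in> ZA \<union> ZN" for z z'
    unfolding gap_def sep_def P_def using liftY[OF that(1)] liftY[OF that(2)] lifte by (simp_all cong: image_cong)
  have swap: "\<exists>z. z \<in> Ext \<and> katetov d m P z \<and> (\<forall>y\<in>Y. z y = g y) \<and> z e0 = g e"
    if g: "katetov d m (insert e Y) g" for g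
  proof -
    let ?z = "restrict (g(e0 := g e)) P"
    have "katetov d m Y g" using katetov_mono[OF g] by blast
    moreover have "d y e0 = d e0 y" "d y e = d e y" if "y \<in> Y" for y
      using d_sym YX[OF that] e0(1) e(1) by auto
    moreover have "d e0 e0 = d e e" using d_zero[OF e0(1,1)] d_zero[OF e(1,1)] by simp
    ultimately have "katetov d m P ?z"
      using g e0(2,3) de eY unfolding katetov_def P_def by auto
    moreover have "?z \<in> Ext" using katetovD(2)[OF g] unfolding Ext_def P_def by auto
    ultimately show ?thesis using e0(2) P(3,4) by (intro exI[of _ ?z]) auto
  qed
  have found: "\<exists>h'\<in>H'. \<forall>y\<in>insert e Y. h' y = g y" if "z \<in> ZA \<union> ZN" "\<forall>y\<in>Y. z y = g y" "z e0 = g e" for z g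
    unfolding H'_def using that liftY[OF that(1)] lifte by (intro bexI[of _ "lift z"]) auto
  have ext: "\<exists>h'\<in>H'. \<forall>y\<in>insert e Y. h' y = g y"
    if h: "h \<in> H" and g: "katetov d m (insert e Y) g" "\<forall>y\<in>Y. g y = h y" "lev Y h \<le> g e + 1" for h g
  proof -
    obtain z where z: "z \<in> Ext" "katetov d m P z" "\<forall>y\<in>Y. z y = g y" "z e0 = g e" using swap[OF g(1)] by blast
    then have "z \<in> ZA" unfolding ZA_def using h g by auto
    then show ?thesis using found[of z g] z by blast
  qed
  have st': "stage (insert e Y) (insert e D') H'"
    unfolding stage_def
  proof (intro conjI ballI allI impI)
    show "finite (insert e D')" "F \<subseteq> insert e Y" "insert e Y \<subseteq> insert e D'" "insert e D' \<subseteq> X" "finite H'"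
      using f2(2,3) S(2) YD' e(1) finA unfolding H'_def by auto
  next
    fix h assume "h \<in> H'"
    then obtain z where z: "z \<in> ZA \<union> ZN" "h = lift z" unfolding H'_def by blast
    then have zZ: "z \<in> Z" "z \<in> G" unfolding Z_def L_def G_def using n\<epsilon>[OF z(1)] by auto
    have lvz: "lv z = lev P z" unfolding lv_def using n\<epsilon>[OF z(1)] by simp
    have T: "T (lev P z) D' (f2 z)" using f2(6)[OF zZ(2)] lvz by simp
    have k: "katetov d m D' (f2 z)" using coherentD(1)[OF f2(4) zZ(1)] .
    \<comment> \<open>Since \<open>z\<close> is a type over \<open>P\<close>, its value at \<open>e0\<close> lies between the extreme distances to \<open>\<epsilon>\<close>, so it is
    also an admissible distance to \<open>e\<close>.\<close>
    have gap_e: "gap P \<epsilon> z \<le> z e0"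
    proof (rule gap_le[OF P(1,2)])
      fix p assume p: "p \<in> P"
      have *: "\<epsilon> p = d p e0" using p d_sym[OF e0(1)] YX e0(1) unfolding \<epsilon>_def P_def by auto
      show "\<epsilon> p \<le> z e0 + z p" using katetovD(4)[OF kZ[OF z(1)] P(4) p] unfolding \<epsilon>_def by simp
      show "z p \<le> z e0 + \<epsilon> p" using katetovD(3)[OF kZ[OF z(1)] p P(4)] * by simp
    qed
    have sep_e: "z e0 \<le> sep m P \<epsilon> z"
    proof (rule sep_ge[OF P(1)])
      show "z e0 \<le> m" using katetovD(2)[OF kZ[OF z(1)] P(4)] .
      fix p assume p: "p \<in> P"
      show "z e0 \<le> \<epsilon> p + z p" using katetovD(3)[OF kZ[OF z(1)] P(4) p] unfolding \<epsilon>_def by simp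
    qed
    have kl: "katetov d m (insert e D') (lift z)"
      unfolding lift_def
    proof (rule katetov_insert[OF f2(2) e(1,2) k])
      show "1 \<le> z e0" "z e0 \<le> m" using katetovD(1,2)[OF kZ[OF z(1)] P(4)] .
      fix y assume y: "y \<in> D'"
      note c = coherentD(3,4)[OF f2(4) _ _ y]
      show "f2 z y \<le> z e0 + d e y" using c(1)[OF zZ(1) \<epsilon>Z] gap_e gap_sym[of P z \<epsilon>] e(3)[OF y] by simp
      show "z e0 \<le> f2 z y + d e y" using c(2)[OF \<epsilon>Z zZ(1)] sep_e e(3)[OF y] by simp
      show "d e y \<le> f2 z y + z e0" using c(1)[OF \<epsilon>Z zZ(1)] gap_e e(3)[OF y] by simp
    qed
    have "T (lev P z) (insert e D') (lift z)"
    proof (rule sys_extend[OF T])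
      show "lev P z \<le> lift z y" if "y \<in> insert e D'" for y
        using that sysD(4)[OF T] levP[OF P(4)] lifte liftD by auto
    qed (use f2(2,3) e(1) kl liftD in auto)
    then show "T (lev (insert e Y) h) (insert e D') h" using tr1[OF z(1)] z(2) by simp
    have "lev P z \<le> r"
    proof (cases "z \<in> ZA")
      case True
      obtain y where "y \<in> Y" "z y = lev Y z" using lev_attained[OF S(6,7)] .
      then show ?thesis using hat(5)[OF True] levP[of y z] P(3) by auto
    next
      case False
      then show ?thesis using z(1) levP[OF P(4), of z] unfolding ZN_def by auto
    qed
    then show "lev (insert e Y) h \<le> r" using tr1[OF z(1)] z(2) by simp
  next
    fix h h' x assume "h \<in> H'" "h' \<in> H'" and x: "x \<in> insert e D'"
    then obtain z z' where z: "z \<in> ZA \<union> ZN" "h = lift z" and z': "z' \<in> ZA \<union> ZN" "h' = lift z'"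
      unfolding H'_def by blast
    have zZ: "z \<in> Z" "z' \<in> Z" using z(1) z'(1) unfolding Z_def L_def by auto
    have "lift z x \<le> gap P z z' + lift z' x \<and> sep m P z z' \<le> lift z x + lift z' x"
    proof (cases "x = e")
      case True
      then show ?thesis using gapP[OF P(4), of z z'] sepP[OF P(4), of m z z'] lifte by simp
    next
      case False
      then show ?thesis using x coherentD(3,4)[OF f2(4) zZ] liftD by simp
    qed
    then show "h x \<le> gap (insert e Y) h h' + h' x" "sep m (insert e Y) h h' \<le> h x + h' x"
      using tr2[OF z(1) z'(1)] z(2) z'(2) by simp_all
  next
    fix g assume "level_type d m r (insert e Y) g \<and> (\<forall>w\<in>F. g w = m)"
    then have g: "katetov d m (insert e Y) g" "\<And>y. y \<in> insert e Y \<Longrightarrow> r \<le> g y" "\<exists>y\<in>insert e Y. g y = r"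
      "\<forall>w\<in>F. g w = m" unfolding level_type_def by auto
    show "\<exists>h\<in>H'. \<forall>y\<in>insert e Y. h y = g y"
    proof (cases "\<exists>y\<in>Y. g y = r")
      case True
      then have "level_type d m r Y g"
        unfolding level_type_def using S(6) g(2) katetov_mono[OF g(1)] by blast
      then obtain h where h: "h \<in> H" "\<forall>y\<in>Y. h y = g y" using S(13) g(4) by blast
      have "lev Y h \<le> g e + 1" using S(10)[OF h(1)] g(2)[of e] by simp
      then show ?thesis using ext[OF h(1) g(1)] h(2) by simp
    next
      case False
      then have ge: "g e = r" using g(3) by blast
      obtain z where z: "z \<in> Ext" "katetov d m P z" "\<forall>y\<in>Y. z y = g y" "z e0 = g e" using swap[OF g(1)] by blast
      have "r + 1 \<le> z y" if "y \<in> Y" for y using g(2)[of y] False z(3) that by force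
      then have "z \<in> ZN" unfolding ZN_def using z g(4) ge S(2) by auto
      then show ?thesis using found[of z g] z by blast
    qed
  qed
  show thesis
  proof (rule that[OF e(1) eY de st' ext])
    fix h assume h: "h \<in> H" "lev Y h = 1" "\<forall>y\<in>Y. h y = t y"
    have "gap Y t h = gap Y t t" using h(3) by (intro gap_cong) auto
    then have "gap Y t h = 0" using gap_refl[OF S(6,7)] by simp
    then have eq: "u x = h x" if "x \<in> D" for x using u(3,4)[OF h(1) that] by simp
    have T: "T 1 D h" using S(9)[OF h(1)] h(2) by simp
    have "T 1 D u"
      by (rule sys_extend[OF T order_refl S(4,1) u(1)]) (use eq katetovD(1)[OF u(1)] in auto)
    then have "\<epsilon> \<in> G" using \<epsilon>Z unfolding G_def by simp
    then have "T 1 D' ?v" using f2(6)[of \<epsilon>] unfolding lv_def by simp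
    then show "e \<in> \<Gamma>" by (rule e(4))
  qed
qed

end

section \<open>Lowering the level of the large types by one\<close>

lemma (in nat_metric) katetov_extend:
  assumes "V \<subseteq> Y" "Y \<subseteq> X" "finite V" "katetov d m V t" "1 \<le> m"
  obtains t' where "katetov d m Y t'" "\<And>y. y \<in> V \<Longrightarrow> t' y = t y"
proof -
  have c: "coherent d m V {()} (\<lambda>_ _. 0) (\<lambda>_ _. 0) (\<lambda>_. 1) (\<lambda>_. t)"
    unfolding coherent_def using assms(4) katetovD(1)[OF assms(4)] by simp
  have c': "coherent d m Y {} (\<lambda>_ _. 0) (\<lambda>_ _. 0) (\<lambda>_. 1) (\<lambda>_. t)"
    unfolding coherent_def by simp
  obtain f' where f': "\<And>z x. z \<in> {()} \<Longrightarrow> x \<in> V \<Longrightarrow> f' z x = t x"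
      "coherent d m Y {()} (\<lambda>_ _. 0) (\<lambda>_ _. 0) (\<lambda>_. 1) f'"
    by (rule amalgamate[OF assms(1-3) _ _ c c']) (use assms(5) in auto)
  show thesis by (rule that[of "f' ()"]) (use f' coherentD(1)[OF f'(2)] in auto)
qed

text \<open>
An extension of \<open>t\<close> being given, \<open>g\<close> is extended in such a way that the two formal points can keep the distance \<open>s\<close>.
A new point of type \<open>t\<close> can then be assigned the value \<open>s\<close>.
\<close>

lemma (in nat_metric) katetov_extend_beside:
  assumes V: "V \<subseteq> Y" "Y \<subseteq> X" "finite V" and t: "katetov d m Y t"
    and g: "katetov d m V g" "\<And>y. y \<in> V \<Longrightarrow> Suc s \<le> g y" "Suc s \<le> m"
    and tg: "\<And>y. y \<in> V \<Longrightarrow> t y = min m (g y + s)"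
  obtains g' where "katetov d m Y g'" "\<And>y. y \<in> V \<Longrightarrow> g' y = g y" "\<And>y. y \<in> Y \<Longrightarrow> Suc s \<le> g' y"
    "\<And>y. y \<in> Y \<Longrightarrow> g' y \<le> s + t y" "\<And>y. y \<in> Y \<Longrightarrow> s \<le> g' y + t y" "\<And>y. y \<in> Y \<Longrightarrow> t y \<le> g' y + s"
proof -
  define a where "a z z' = (if z = z' then 0 else s)" for z z' :: bool
  define lv where "lv z = (if z then 1 else Suc s)" for z
  define f where "f z = (if z then t else g)" for z
  have tV: "katetov d m V t" using katetov_mono[OF t V(1)] .
  have tgV: "t y \<le> s + g y" "g y \<le> s + t y" "s \<le> t y + g y" if "y \<in> V" for y
    using tg[OF that] katetovD(2)[OF g(1) that] g(2)[OF that] by (simp_all add: min_def)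
  have c: "coherent d m V UNIV a a lv f"
    unfolding coherent_def a_def lv_def f_def
    using tV g(1,2) katetovD(1)[OF tV] tgV by (auto simp: add.commute)
  have c': "coherent d m Y {True} a a lv f"
    unfolding coherent_def a_def lv_def f_def using t katetovD(1)[OF t] by simp
  obtain f' where f': "\<And>z x. z \<in> UNIV \<Longrightarrow> x \<in> V \<Longrightarrow> f' z x = f z x"
      "\<And>z x. z \<in> {True} \<Longrightarrow> x \<in> Y \<Longrightarrow> f' z x = f z x" "coherent d m Y UNIV a a lv f'"
    by (rule amalgamate[OF V _ _ c c']) (use g(3) in \<open>auto simp: a_def lv_def\<close>)
  note co = coherentD[OF f'(3)]
  have ft: "f' True y = t y" if "y \<in> Y" for y using f'(2)[of True y] that unfolding f_def by simp
  show thesis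
  proof (rule that[of "f' False"])
    show "katetov d m Y (f' False)" using co(1) by blast
    show "f' False y = g y" if "y \<in> V" for y using f'(1)[of False y] that unfolding f_def by simp
    fix y assume y: "y \<in> Y"
    show "Suc s \<le> f' False y" using co(2)[of False y] y unfolding lv_def by simp
    show "f' False y \<le> s + t y" using co(3)[of False True y] y ft[OF y] unfolding a_def by simp
    show "s \<le> f' False y + t y" using co(4)[of False True y] y ft[OF y] unfolding a_def by simp
    show "t y \<le> f' False y + s" using co(3)[of True False y] y ft[OF y] unfolding a_def by simp
  qed
qed

lemma finite_subset_UN_chain:
  assumes "finite V" "V \<subseteq> (\<Union>k. Y k)" "\<And>i j :: nat. i \<le> j \<Longrightarrow> Y i \<subseteq> Y j"
  obtains k where "V \<subseteq> Y k"
proof -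
  have "\<exists>k. V \<subseteq> Y k" using assms(1,2)
  proof (induction V)
    case (insert v V)
    then obtain i j where "V \<subseteq> Y i" "v \<in> Y j" by blast
    then have "insert v V \<subseteq> Y (max i j)" using assms(3)[of i "max i j"] assms(3)[of j "max i j"] by auto
    then show ?case by blast
  qed simp
  then show thesis using that by blast
qed

text \<open>
A bookkeeping sequence that meets every type over a finite set infinitely often.
\<close>

lemma countable_tasks:
  assumes "countable X"
  obtains task :: "nat \<Rightarrow> 'a set \<times> ('a \<Rightarrow> nat)" where
    "\<And>V t k0. finite V \<Longrightarrow> V \<subseteq> X \<Longrightarrow> t \<in> V \<rightarrow>\<^sub>E {..m} \<Longrightarrow> \<exists>k\<ge>k0. task k = (V, t)"
proof -
  define K where "K = (SIGMA V:{V. finite V \<and> V \<subseteq> X}. V \<rightarrow>\<^sub>E {..m::nat})"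
  have K: "countable K"
    unfolding K_def
  proof (rule countable_SIGMA)
    show "countable {V. finite V \<and> V \<subseteq> X}" using countable_Collect_finite_subset[OF assms] .
    show "countable (V \<rightarrow>\<^sub>E {..m})" if "V \<in> {V. finite V \<and> V \<subseteq> X}" for V
      using that by (intro countable_PiE) simp_all
  qed
  have *: "\<exists>k\<ge>k0. from_nat_into K (fst (prod_decode k)) = (V, t)"
    if "finite V" "V \<subseteq> X" "t \<in> V \<rightarrow>\<^sub>E {..m}" for V t k0
  proof -
    have "(V, t) \<in> K" using that unfolding K_def by blast
    then obtain n where "from_nat_into K n = (V, t)" using from_nat_into_surj[OF K] by blast
    then show ?thesis by (intro exI[of _ "prod_encode (n, k0)"]) (simp add: le_prod_encode_2)
  qed
  show thesis by (rule that[of "\<lambda>k. from_nat_into K (fst (prod_decode k))"]) (rule *)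
qed

context refinement
begin

text \<open>
A type over \<open>V\<close> counts as large in the union \<open>E\<close> of the stages if from some stage on each of its
extensions, of the same level, to the finite set \<open>Y k\<close> has a hat. This makes closure under extensions
of the same level immediate, and types of level \<open>r\<close> that are \<open>m\<close> on \<open>F\<close> are large by the definition of a
stage. All else is a matter of fairness: the types of the points added at the various stages extend
every possible type infinitely often. The type of the added point is the raised
type \<open>min m (g y + s)\<close> in order to lower the level of \<open>g\<close> to \<open>s\<close>, and \<open>g\<close> itself in order to
realise \<open>g\<close>.
\<close>

lemma refine:
  "\<exists>E T'. F \<subseteq> E \<and> E \<subseteq> X \<and> urysohn_space E d m \<and> large_system d m \<Gamma> E T' \<and>
     (\<forall>V g. F \<subseteq> V \<and> V \<subseteq> E \<and> level_type d m r V g \<and> (\<forall>w\<in>F. g w = m) \<longrightarrow> T' r V g)"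
proof -
  have m1: "1 \<le> m" using r by simp
  obtain task :: "nat \<Rightarrow> 'a set \<times> ('a \<Rightarrow> nat)" where task:
    "\<And>V t k0. finite V \<Longrightarrow> V \<subseteq> X \<Longrightarrow> t \<in> V \<rightarrow>\<^sub>E {..m} \<Longrightarrow> \<exists>k\<ge>k0. task k = (V, t)"
    by (rule countable_tasks[OF countable, of m]) blast
  define good where "good k Y t \<longleftrightarrow> katetov d m Y t \<and>
     (fst (task k) \<subseteq> Y \<and> katetov d m (fst (task k)) (snd (task k)) \<longrightarrow>
        (\<forall>y\<in>fst (task k). t y = snd (task k) y))" for k Y t
  have good_ex: "\<exists>t. good k Y t" if Y: "finite Y" "Y \<subseteq> X" for k Y
  proof (cases "fst (task k) \<subseteq> Y \<and> katetov d m (fst (task k)) (snd (task k))")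
    case True
    have "finite (fst (task k))" using True Y(1) finite_subset by blast
    then show ?thesis
      using katetov_extend[of "fst (task k)" Y "snd (task k)"] True Y(2) m1 unfolding good_def by metis
  next
    case False
    have "katetov d m Y (\<lambda>_. m)"
      unfolding katetov_def using m1 d_le Y(2) by (auto intro: trans_le_add1)
    then show ?thesis unfolding good_def using False by blast
  qed
  define hatted where "hatted H Y g \<longleftrightarrow> (\<exists>h\<in>H. \<forall>y\<in>Y. h y = g y)" for H Y and g :: "'a \<Rightarrow> nat"
  define St where "St \<sigma> = (case \<sigma> of (Y, D, H) \<Rightarrow> stage Y D H)" for \<sigma>
  define Nx where "Nx k \<sigma> \<sigma>' = (case \<sigma> of (Y, D, H) \<Rightarrow> case \<sigma>' of (Y', D', H') \<Rightarrow>
     \<exists>e t. good k Y t \<and> e \<in> X \<and> e \<notin> Y \<and> Y' = insert e Y \<and> (\<forall>y\<in>Y. d e y = t y) \<and>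
      (\<forall>h g. h \<in> H \<and> katetov d m Y' g \<and> (\<forall>y\<in>Y. g y = h y) \<and> lev Y h \<le> g e + 1 \<longrightarrow> hatted H' Y' g) \<and>
      (\<forall>h. h \<in> H \<and> lev Y h = 1 \<and> (\<forall>y\<in>Y. h y = t y) \<longrightarrow> e \<in> \<Gamma>))" for k :: nat and \<sigma> \<sigma>' :: "'a set \<times> 'a set \<times> ('a \<Rightarrow> nat) set"
  have "\<exists>\<sigma>. (\<forall>k. St (\<sigma> k)) \<and> (\<forall>k. Nx k (\<sigma> k) (\<sigma> (Suc k))) \<and> \<sigma> 0 = (F, F, {})"
  proof -
    have "\<exists>\<sigma>. \<forall>k. (St (\<sigma> k) \<and> (k = 0 \<longrightarrow> \<sigma> k = (F, F, {}))) \<and> Nx k (\<sigma> k) (\<sigma> (Suc k))"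
    proof (rule dependent_nat_choice)
      show "\<exists>\<sigma>. St \<sigma> \<and> (0 = 0 \<longrightarrow> \<sigma> = (F, F, {}))" using stage_start unfolding St_def by auto
      fix \<sigma> and k :: nat assume "St \<sigma> \<and> (k = 0 \<longrightarrow> \<sigma> = (F, F, {}))"
      then obtain Y D H where \<sigma>: "\<sigma> = (Y, D, H)" and st: "stage Y D H" unfolding St_def by (cases \<sigma>) auto
      obtain t where t: "good k Y t" using good_ex stageD(6,8)[OF st] by blast
      then have kt: "katetov d m Y t" unfolding good_def by blast
      obtain e D' H' where e: "e \<in> X" "e \<notin> Y" "\<And>y. y \<in> Y \<Longrightarrow> d e y = t y" "stage (insert e Y) D' H'"
        "\<And>h g. h \<in> H \<Longrightarrow> katetov d m (insert e Y) g \<Longrightarrow> \<forall>y\<in>Y. g y = h y \<Longrightarrow> lev Y h \<le> g e + 1 \<Longrightarrow>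
            \<exists>h'\<in>H'. \<forall>y\<in>insert e Y. h' y = g y"
        "\<And>h. h \<in> H \<Longrightarrow> lev Y h = 1 \<Longrightarrow> \<forall>y\<in>Y. h y = t y \<Longrightarrow> e \<in> \<Gamma>"
        by (rule stage_step[OF st kt]) (assumption | (rule that; assumption))+
      have "Nx k \<sigma> (insert e Y, D', H')"
        unfolding Nx_def \<sigma> prod.case hatted_def
        by (intro exI[of _ e] exI[of _ t] conjI allI impI t e(1-3) refl ballI) (use e(5,6) in blast)+
      then show "\<exists>\<sigma>'. (St \<sigma>' \<and> (Suc k = 0 \<longrightarrow> \<sigma>' = (F, F, {}))) \<and> Nx k \<sigma> \<sigma>'"
        using e(4) unfolding St_def by (intro exI[of _ "(insert e Y, D', H')"]) simp
    qed
    then show ?thesis by blast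
  qed
  then obtain \<sigma> where \<sigma>: "\<And>k. St (\<sigma> k)" "\<And>k. Nx k (\<sigma> k) (\<sigma> (Suc k))" "\<sigma> 0 = (F, F, {})" by blast
  define Y where "Y k = fst (\<sigma> k)" for k
  define D where "D k = fst (snd (\<sigma> k))" for k
  define H where "H k = snd (snd (\<sigma> k))" for k
  have \<sigma>_eq: "\<sigma> k = (Y k, D k, H k)" for k unfolding Y_def D_def H_def by simp
  have st: "stage (Y k) (D k) (H k)" for k using \<sigma>(1)[of k] unfolding St_def \<sigma>_eq by simp
  define Q where "Q k e t \<longleftrightarrow> good k (Y k) t \<and> e \<in> X \<and> e \<notin> Y k \<and> Y (Suc k) = insert e (Y k) \<and>
      (\<forall>y\<in>Y k. d e y = t y) \<and>
      (\<forall>h g. h \<in> H k \<and> katetov d m (Y (Suc k)) g \<and> (\<forall>y\<in>Y k. g y = h y) \<and> lev (Y k) h \<le> g e + 1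
         \<longrightarrow> hatted (H (Suc k)) (Y (Suc k)) g) \<and>
      (\<forall>h. h \<in> H k \<and> lev (Y k) h = 1 \<and> (\<forall>y\<in>Y k. h y = t y) \<longrightarrow> e \<in> \<Gamma>)" for k e t
  have "\<exists>e t. Q k e t" for k
    using \<sigma>(2)[of k] unfolding Nx_def \<sigma>_eq prod.case Q_def .
  then obtain e t where Q: "\<And>k. Q k (e k) (t k)" by metis
  have nx: "good k (Y k) (t k)" "e k \<in> X" "e k \<notin> Y k"
      "Y (Suc k) = insert (e k) (Y k)" "\<And>y. y \<in> Y k \<Longrightarrow> d (e k) y = t k y"
      "\<And>h g. h \<in> H k \<Longrightarrow> katetov d m (Y (Suc k)) g \<Longrightarrow> \<forall>y\<in>Y k. g y = h y \<Longrightarrow>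
         lev (Y k) h \<le> g (e k) + 1 \<Longrightarrow> hatted (H (Suc k)) (Y (Suc k)) g"
      "\<And>h. h \<in> H k \<Longrightarrow> lev (Y k) h = 1 \<Longrightarrow> \<forall>y\<in>Y k. h y = t k y \<Longrightarrow> e k \<in> \<Gamma>" for k
    using Q[of k, unfolded Q_def] by - (elim conjE, blast)+
  have Y0: "Y 0 = F" using \<sigma>(3) unfolding Y_def by simp
  have finY: "finite (Y k)" and YX: "Y k \<subseteq> X" for k using stageD(6,8)[OF st] by auto
  have Ymono: "Y i \<subseteq> Y j" if "i \<le> j" for i j
    using that by (rule lift_Suc_mono_le[rotated]) (use nx(4) in auto)
  define E where "E = (\<Union>k. Y k)"
  have YE: "Y k \<subseteq> E" for k unfolding E_def by blast
  have EX: "E \<subseteq> X" unfolding E_def using YX by blast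
  have eE: "e k \<in> E" for k using nx(4)[of k] YE[of "Suc k"] by blast
  have FE: "F \<subseteq> E" using YE[of 0] Y0 by simp
  have kt: "katetov d m (Y k) (t k)" for k using nx(1) unfolding good_def by blast
  have fair: "\<exists>k\<ge>k0. V \<subseteq> Y k \<and> (\<forall>y\<in>V. t k y = g y)"
    if V: "finite V" "V \<subseteq> E" and g: "katetov d m V g" for V g k0
  proof -
    obtain i where i: "V \<subseteq> Y i" using finite_subset_UN_chain[OF V(1) V(2)[unfolded E_def] Ymono] by blast
    let ?g = "restrict g V"
    have "?g \<in> V \<rightarrow>\<^sub>E {..m}" using katetovD(2)[OF g] by auto
    then obtain k where k: "k \<ge> max k0 i" "task k = (V, ?g)"
      using task[OF V(1), of ?g "max k0 i"] V(2) EX by blast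
    have "V \<subseteq> Y k" using i Ymono[of i k] k(1) by auto
    moreover have "katetov d m V ?g" using g katetov_cong[of V ?g g d m] by simp
    ultimately have "\<forall>y\<in>V. t k y = ?g y" using nx(1)[of k] k(2) unfolding good_def by simp
    then show ?thesis using \<open>V \<subseteq> Y k\<close> k(1) by (intro exI[of _ k]) auto
  qed
  \<comment> \<open>Once a type over a stage has a hat, so do its extensions of the same level to later stages.\<close>
  have persist: "hatted (H k') (Y k') g'"
    if "k \<le> k'" and g: "hatted (H k) (Y k) g" "level_type d m s (Y k) g"
      and g': "level_type d m s (Y k') g'" "\<forall>y\<in>Y k. g' y = g y" for k k' g g' s
    using \<open>k \<le> k'\<close> g'
  proof (induction k' arbitrary: g' rule: dec_induct)
    case base
    then show ?case using g(1) unfolding hatted_def by simp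
  next
    case (step n)
    have sub: "Y k \<subseteq> Y n" using Ymono step by simp
    have lt: "level_type d m s (Y n) g'"
      unfolding level_type_def
    proof (intro conjI ballI)
      show "katetov d m (Y n) g'" using step.prems(1) katetov_mono nx(4)[of n] unfolding level_type_def by blast
      show "s \<le> g' y" if "y \<in> Y n" for y using step.prems(1) that nx(4)[of n] unfolding level_type_def by blast
      obtain y where "y \<in> Y k" "g y = s" using g(2) unfolding level_type_def by blast
      then show "\<exists>y\<in>Y n. g' y = s" using step.prems(2) sub by (intro bexI[of _ y]) auto
    qed (rule finY)
    then obtain h where h: "h \<in> H n" "\<forall>y\<in>Y n. h y = g' y"
      using step.IH[OF lt step.prems(2)] unfolding hatted_def by blast
    have "lev (Y n) h = lev (Y n) g'" using h(2) by (intro lev_cong) blast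
    moreover have "lev (Y n) g' = s" using lt unfolding level_type_def by (metis lev_eqI)
    moreover have "s \<le> g' (e n)" using step.prems(1) nx(4)[of n] unfolding level_type_def by blast
    ultimately show ?case
      using nx(6)[OF h(1), of g'] h(2) step.prems(1) unfolding level_type_def by simp
  qed
  define T' where "T' s V g \<longleftrightarrow> V \<subseteq> E \<and> level_type d m s V g \<and>
     (\<exists>k0. \<forall>k\<ge>k0. \<forall>g'. V \<subseteq> Y k \<and> level_type d m s (Y k) g' \<and> (\<forall>y\<in>V. g' y = g y) \<longrightarrow> hatted (H k) (Y k) g')"
    for s V g
  have T'_hatted: "T' s (Y k) g" if "hatted (H k) (Y k) g" "level_type d m s (Y k) g" for s k g
    unfolding T'_def using that YE persist[OF _ that] by (intro conjI exI[of _ k]) auto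
  have lvh: "lev (Y k) h = s" if "\<forall>y\<in>Y k. h y = g y" "level_type d m s (Y k) g" for k h g s
  proof -
    have "lev (Y k) h = lev (Y k) g" using that(1) by (intro lev_cong) blast
    then show ?thesis using that(2) unfolding level_type_def by (metis lev_eqI)
  qed
  have E: "urysohn_space E d m"
  proof
    show "countable E" using countable EX countable_subset by blast
    fix V g assume V: "finite V" "V \<subseteq> E" and g: "katetov d m V g"
    obtain k where "V \<subseteq> Y k" "\<forall>y\<in>V. t k y = g y" using fair[OF V g, of 0] by blast
    then show "\<exists>e\<in>E. \<forall>y\<in>V. d e y = g y" using nx(5) eE by (intro bexI[of _ "e k"]) auto
  qed (intro d_zero d_sym d_tri d_le subsetD[OF EX]; assumption)+
  have sys': "large_system d m \<Gamma> E T'"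
    unfolding large_system_def
  proof (intro conjI allI impI)
    show "V \<subseteq> E" "level_type d m s V g" if "T' s V g" for s V g using that unfolding T'_def by auto
  next
    fix s V g V' g' assume *: "T' s V g \<and> V \<subseteq> V' \<and> V' \<subseteq> E \<and> level_type d m s V' g' \<and> (\<forall>y\<in>V. g' y = g y)"
    then obtain k0 where k0: "\<And>k g'. k \<ge> k0 \<Longrightarrow> V \<subseteq> Y k \<Longrightarrow> level_type d m s (Y k) g' \<Longrightarrow>
        \<forall>y\<in>V. g' y = g y \<Longrightarrow> hatted (H k) (Y k) g'" unfolding T'_def by blast
    show "T' s V' g'" unfolding T'_def
    proof (intro conjI exI[of _ k0] allI impI)
      fix k g'' assume k: "k0 \<le> k" and "V' \<subseteq> Y k \<and> level_type d m s (Y k) g'' \<and> (\<forall>y\<in>V'. g'' y = g' y)"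
      then show "hatted (H k) (Y k) g''" using * by (intro k0[OF k]) auto
    qed (use * in auto)
  next
    fix s V g assume "T' (Suc s) V g \<and> 0 < s"
    then obtain k0 where V: "V \<subseteq> E" "level_type d m (Suc s) V g" and s: "0 < s"
      and k0: "\<And>k g'. k \<ge> k0 \<Longrightarrow> V \<subseteq> Y k \<Longrightarrow> level_type d m (Suc s) (Y k) g' \<Longrightarrow>
        \<forall>y\<in>V. g' y = g y \<Longrightarrow> hatted (H k) (Y k) g'" unfolding T'_def by blast
    have g: "finite V" "katetov d m V g" "\<And>y. y \<in> V \<Longrightarrow> Suc s \<le> g y" "\<exists>y\<in>V. g y = Suc s"
      using V(2) unfolding level_type_def by auto
    have sm: "Suc s \<le> m" using g(4) katetovD(2)[OF g(2)] by fastforce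
    have VX: "V \<subseteq> X" using V(1) EX by blast
    have "katetov d m V (\<lambda>y. min m (g y + s))" using katetov_raise[OF VX g(2)] s sm by simp
    then obtain k where k: "k0 \<le> k" "V \<subseteq> Y k" "\<And>y. y \<in> V \<Longrightarrow> t k y = min m (g y + s)"
      using fair[OF g(1) V(1)] by blast
    obtain g' where g': "katetov d m (Y k) g'" "\<And>y. y \<in> V \<Longrightarrow> g' y = g y" "\<And>y. y \<in> Y k \<Longrightarrow> Suc s \<le> g' y"
      "\<And>y. y \<in> Y k \<Longrightarrow> g' y \<le> s + t k y" "\<And>y. y \<in> Y k \<Longrightarrow> s \<le> g' y + t k y" "\<And>y. y \<in> Y k \<Longrightarrow> t k y \<le> g' y + s"
      using katetov_extend_beside[OF k(2) YX g(1) kt g(2,3) sm k(3)] by metis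
    have lt: "level_type d m (Suc s) (Y k) g'"
      unfolding level_type_def using finY g'(1-3) g(4) k(2) by (metis subsetD)
    obtain h where h: "h \<in> H k" "\<forall>y\<in>Y k. h y = g' y"
      using k0[OF k(1,2) lt] g'(2) unfolding hatted_def by blast
    let ?g = "g'(e k := s)"
    have kg: "katetov d m (Y (Suc k)) ?g"
      unfolding nx(4)
      by (rule katetov_insert[OF YX nx(2,3) g'(1)]) (use s sm g'(4-6) nx(5)[of _ k] in auto)
    have gY: "?g y = g' y" if "y \<in> Y k" for y using that nx(3)[of k] by auto
    have "hatted (H (Suc k)) (Y (Suc k)) ?g"
      using nx(6)[OF h(1) kg] h(2) gY lvh[OF h(2) lt] by simp
    moreover have "level_type d m s (Y (Suc k)) ?g"
      unfolding level_type_def using kg finY nx(4)[of k] g'(3) by (auto intro: Suc_leD)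
    ultimately have "T' s (Y (Suc k)) ?g" by (rule T'_hatted)
    moreover have "V \<subseteq> Y (Suc k)" using k(2) nx(4) by blast
    moreover have "\<forall>y\<in>V. ?g y = g y"
    proof
      fix y assume y: "y \<in> V"
      then show "?g y = g y" using gY[of y] g'(2)[OF y] k(2) by (metis subsetD)
    qed
    ultimately show "\<exists>V' g'. V \<subseteq> V' \<and> (\<forall>y\<in>V. g' y = g y) \<and> T' s V' g'" by blast
  next
    fix V g assume "T' 1 V g"
    then obtain k0 where V: "V \<subseteq> E" "level_type d m 1 V g"
      and k0: "\<And>k g'. k \<ge> k0 \<Longrightarrow> V \<subseteq> Y k \<Longrightarrow> level_type d m 1 (Y k) g' \<Longrightarrow>
        \<forall>y\<in>V. g' y = g y \<Longrightarrow> hatted (H k) (Y k) g'" unfolding T'_def by blast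
    have g: "finite V" "katetov d m V g" "\<exists>y\<in>V. g y = 1" using V(2) unfolding level_type_def by auto
    obtain k where k: "k0 \<le> k" "V \<subseteq> Y k" "\<And>y. y \<in> V \<Longrightarrow> t k y = g y"
      using fair[OF g(1) V(1) g(2)] by blast
    have lt: "level_type d m 1 (Y k) (t k)"
      unfolding level_type_def using finY kt katetovD(1)[OF kt] g(3) k(2,3) by (metis subsetD)
    obtain h where h: "h \<in> H k" "\<forall>y\<in>Y k. h y = t k y"
      using k0[OF k(1,2) lt] k(3) unfolding hatted_def by blast
    have "e k \<in> \<Gamma>" using nx(7)[OF h(1) lvh[OF h(2) lt] h(2)] .
    then show "\<exists>x\<in>E \<inter> \<Gamma>. \<forall>y\<in>V. d x y = g y"
      using eE nx(5) k(2,3) by (intro bexI[of _ "e k"]) auto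
  qed
  have "T' r V g" if "F \<subseteq> V" "V \<subseteq> E" "level_type d m r V g" "\<forall>w\<in>F. g w = m" for V g
  proof -
    have "hatted (H k) (Y k) g'" if g': "level_type d m r (Y k) g'" "\<forall>y\<in>V. g' y = g y" for k g'
      unfolding hatted_def using stageD(13)[OF st g'(1)] g'(2) \<open>\<forall>w\<in>F. g w = m\<close> \<open>F \<subseteq> V\<close> by (metis subsetD)
    then show ?thesis unfolding T'_def using that by blast
  qed
  then show ?thesis using FE EX E sys' by blast
qed

end

section \<open>Large sets of points\<close>

text \<open>
At level 0 no condition is put on the extension, because level 0 stands for the realisation of
a type by a point.
\<close>

definition type_extends ::
  "'a set \<Rightarrow> ('a \<Rightarrow> 'a \<Rightarrow> nat) \<Rightarrow> nat \<Rightarrow> nat \<Rightarrow> 'a set \<Rightarrow> ('a \<Rightarrow> nat) \<Rightarrow> 'a set \<Rightarrow> ('a \<Rightarrow> nat) \<Rightarrow> bool" where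
  "type_extends X d m s Y g Y' g' \<longleftrightarrow>
     Y \<subseteq> Y' \<and> Y' \<subseteq> X \<and> (\<forall>y\<in>Y. g' y = g y) \<and> (0 < s \<longrightarrow> level_type d m s Y' g')"

primrec large :: "'a set \<Rightarrow> ('a \<Rightarrow> 'a \<Rightarrow> nat) \<Rightarrow> nat \<Rightarrow> 'a set \<Rightarrow> nat \<Rightarrow> 'a set \<Rightarrow> ('a \<Rightarrow> nat) \<Rightarrow> bool"
  where
  "large X d m \<Gamma> 0 Y g \<longleftrightarrow> (\<exists>x\<in>X \<inter> \<Gamma>. \<forall>y\<in>Y. d x y = g y)"
| "large X d m \<Gamma> (Suc s) Y g \<longleftrightarrow>
     (\<forall>Y1 g1. type_extends X d m (Suc s) Y g Y1 g1 \<longrightarrow>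
        (\<exists>Y2 g2. type_extends X d m s Y1 g1 Y2 g2 \<and> large X d m \<Gamma> s Y2 g2))"

lemma largeD:
  "large X d m \<Gamma> (Suc s) Y g \<Longrightarrow> type_extends X d m (Suc s) Y g Y1 g1 \<Longrightarrow>
     \<exists>Y2 g2. type_extends X d m s Y1 g1 Y2 g2 \<and> large X d m \<Gamma> s Y2 g2"
  by simp

lemma type_extends_trans:
  "type_extends X d m s' Y g Y1 g1 \<Longrightarrow> type_extends X d m s Y1 g1 Y2 g2 \<Longrightarrow> type_extends X d m s Y g Y2 g2"
  unfolding type_extends_def by auto

lemma type_extends_refl:
  "Y \<subseteq> X \<Longrightarrow> (0 < s \<longrightarrow> level_type d m s Y g) \<Longrightarrow> type_extends X d m s Y g Y g"
  unfolding type_extends_def by simp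

lemma large_type_extends:
  assumes "large X d m \<Gamma> (Suc s) Y g" "type_extends X d m (Suc s) Y g Y' g'"
  shows "large X d m \<Gamma> (Suc s) Y' g'"
  using largeD[OF assms(1) type_extends_trans[OF assms(2)]] by simp

lemma level_type_pos: "level_type d m s Y g \<Longrightarrow> 1 \<le> s \<and> s \<le> m"
  unfolding level_type_def katetov_def by blast

lemma large_system_large:
  "large_system d m \<Gamma> X (\<lambda>s Y g. Y \<subseteq> X \<and> level_type d m s Y g \<and> large X d m \<Gamma> s Y g)"
  unfolding large_system_def
proof (intro conjI allI impI)
  fix s Y g Y' g'
  assume *: "(Y \<subseteq> X \<and> level_type d m s Y g \<and> large X d m \<Gamma> s Y g) \<and> Y \<subseteq> Y' \<and> Y' \<subseteq> X \<and>
    level_type d m s Y' g' \<and> (\<forall>y\<in>Y. g' y = g y)"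
  then have "1 \<le> s" using level_type_pos by blast
  then obtain s' where s': "s = Suc s'" by (cases s) auto
  have "large X d m \<Gamma> s Y g" "type_extends X d m s Y g Y' g'" using * unfolding type_extends_def by simp_all
  then show "large X d m \<Gamma> s Y' g'" unfolding s' by (rule large_type_extends)
next
  fix s Y g
  assume *: "(Y \<subseteq> X \<and> level_type d m (Suc s) Y g \<and> large X d m \<Gamma> (Suc s) Y g) \<and> 0 < s"
  then have l: "large X d m \<Gamma> (Suc s) Y g" and r: "type_extends X d m (Suc s) Y g Y g"
    using type_extends_refl[of Y X "Suc s" d m g] by blast+
  obtain Y2 g2 where "type_extends X d m s Y g Y2 g2" "large X d m \<Gamma> s Y2 g2"
    using largeD[OF l r] by blast
  then show "\<exists>Y' g'. Y \<subseteq> Y' \<and> (\<forall>y\<in>Y. g' y = g y) \<and> Y' \<subseteq> X \<and> level_type d m s Y' g' \<and> large X d m \<Gamma> s Y' g'"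
    using * unfolding type_extends_def by blast
next
  fix Y g
  assume *: "Y \<subseteq> X \<and> level_type d m 1 Y g \<and> large X d m \<Gamma> 1 Y g"
  then have l: "large X d m \<Gamma> (Suc 0) Y g" and r: "type_extends X d m (Suc 0) Y g Y g"
    using type_extends_refl[of Y X "Suc 0" d m g] by simp_all
  obtain Y2 g2 where 2: "type_extends X d m 0 Y g Y2 g2" "large X d m \<Gamma> 0 Y2 g2"
    using largeD[OF l r] by blast
  then obtain x where "x \<in> X \<inter> \<Gamma>" "\<forall>y\<in>Y2. d x y = g2 y" by auto
  then show "\<exists>x\<in>X \<inter> \<Gamma>. \<forall>y\<in>Y. d x y = g y" using 2(1) unfolding type_extends_def by (metis subsetD)
qed blast+

text \<open>
Suppose that no extension of the same level is large for \<open>\<Gamma>1\<close>. Then every extension can be extended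
further so that all types of smaller level above it fail to be large for \<open>\<Gamma>1\<close>; since some type above
it is large for the union, the induction hypothesis makes one of them large for \<open>\<Gamma>2\<close>.
\<close>

lemma large_Un:
  assumes "large X d m (\<Gamma>1 \<union> \<Gamma>2) s Y g" "Y \<subseteq> X" "0 < s \<longrightarrow> level_type d m s Y g"
  shows "\<exists>Y' g'. type_extends X d m s Y g Y' g' \<and> (large X d m \<Gamma>1 s Y' g' \<or> large X d m \<Gamma>2 s Y' g')"
  using assms
proof (induction s arbitrary: Y g)
  case 0
  then have "large X d m \<Gamma>1 0 Y g \<or> large X d m \<Gamma>2 0 Y g" by auto
  then show ?case using type_extends_refl[OF 0(2,3)] by blast
next
  case (Suc s)
  show ?case
  proof (cases "\<exists>Y' g'. type_extends X d m (Suc s) Y g Y' g' \<and> large X d m \<Gamma>1 (Suc s) Y' g'")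
    case True
    then show ?thesis by blast
  next
    case False
    have "large X d m \<Gamma>2 (Suc s) Y g"
      unfolding large.simps
    proof (intro allI impI)
      fix Y1 g1
      assume 1: "type_extends X d m (Suc s) Y g Y1 g1"
      then have "\<not> large X d m \<Gamma>1 (Suc s) Y1 g1" using False by blast
      then obtain Y2 g2 where 2: "type_extends X d m (Suc s) Y1 g1 Y2 g2"
        and no: "\<And>Y3 g3. type_extends X d m s Y2 g2 Y3 g3 \<Longrightarrow> \<not> large X d m \<Gamma>1 s Y3 g3"
        unfolding large.simps by blast
      obtain Y3 g3 where 3: "type_extends X d m s Y2 g2 Y3 g3" "large X d m (\<Gamma>1 \<union> \<Gamma>2) s Y3 g3"
        using largeD[OF Suc.prems(1) type_extends_trans[OF 1 2]] by blast
      then have "Y3 \<subseteq> X" "0 < s \<longrightarrow> level_type d m s Y3 g3" unfolding type_extends_def by blast+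
      from Suc.IH[OF 3(2) this] obtain Y4 g4 where 4: "type_extends X d m s Y3 g3 Y4 g4"
          "large X d m \<Gamma>1 s Y4 g4 \<or> large X d m \<Gamma>2 s Y4 g4" by blast
      note e = type_extends_trans[OF 3(1) 4(1)]
      have "large X d m \<Gamma>2 s Y4 g4" using no[OF e] 4(2) by blast
      then show "\<exists>Y2 g2. type_extends X d m s Y1 g1 Y2 g2 \<and> large X d m \<Gamma>2 s Y2 g2"
        using type_extends_trans[OF 2 e] by blast
    qed
    then show ?thesis using type_extends_refl[OF Suc.prems(2,3)] by blast
  qed
qed

lemma large_UN:
  assumes "large X d m (\<Union>i<Suc k. \<Gamma> i) s Y g" "Y \<subseteq> X" "level_type d m s Y g"
  shows "\<exists>i Y' g'. type_extends X d m s Y g Y' g' \<and> large X d m (\<Gamma> i) s Y' g'"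
  using assms
proof (induction k arbitrary: Y g)
  case 0
  then show ?case using type_extends_refl[of Y X s d m g] by (auto simp: lessThan_Suc)
next
  case (Suc k)
  have "(\<Union>i<Suc (Suc k). \<Gamma> i) = \<Gamma> (Suc k) \<union> (\<Union>i<Suc k. \<Gamma> i)"
    using lessThan_Suc[of "Suc k"] by simp
  then have l: "large X d m (\<Gamma> (Suc k) \<union> (\<Union>i<Suc k. \<Gamma> i)) s Y g" using Suc.prems(1) by simp
  have "0 < s \<longrightarrow> level_type d m s Y g" using Suc.prems(3) by simp
  from large_Un[OF l Suc.prems(2) this]
  obtain Y' g' where Y': "type_extends X d m s Y g Y' g'"
      "large X d m (\<Gamma> (Suc k)) s Y' g' \<or> large X d m (\<Union>i<Suc k. \<Gamma> i) s Y' g'"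
    by blast
  from Y'(2) show ?case
  proof
    assume "large X d m (\<Gamma> (Suc k)) s Y' g'"
    then show ?thesis using Y'(1) by blast
  next
    assume l: "large X d m (\<Union>i<Suc k. \<Gamma> i) s Y' g'"
    have "0 < s" using level_type_pos[OF Suc.prems(3)] by simp
    then have "Y' \<subseteq> X" "level_type d m s Y' g'" using Y'(1) unfolding type_extends_def by blast+
    from Suc.IH[OF l this] show ?thesis using type_extends_trans[OF Y'(1)] by blast
  qed
qed

lemma (in urysohn_space) large_everything:
  assumes "finite Y" "Y \<subseteq> X" "katetov d m Y g" "X \<subseteq> \<Gamma>"
  shows "large X d m \<Gamma> s Y g"
  using assms(1-3)
proof (induction s arbitrary: Y g)
  case 0
  then obtain e where "e \<in> X" "\<forall>y\<in>Y. d e y = g y" using realise by blast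
  then show ?case using assms(4) by auto
next
  case (Suc s)
  show ?case unfolding large.simps
  proof (intro allI impI)
    fix Y1 g1 assume "type_extends X d m (Suc s) Y g Y1 g1"
    then have 1: "Y1 \<subseteq> X" "level_type d m (Suc s) Y1 g1" unfolding type_extends_def by simp_all
    then have l: "finite Y1" "Y1 \<subseteq> X" "katetov d m Y1 g1" "\<And>y. y \<in> Y1 \<Longrightarrow> Suc s \<le> g1 y" "Suc s \<le> m"
      using level_type_pos[OF 1(2)] unfolding level_type_def by simp_all
    show "\<exists>Y2 g2. type_extends X d m s Y1 g1 Y2 g2 \<and> large X d m \<Gamma> s Y2 g2"
    proof (cases "0 < s")
      case False
      then show ?thesis using Suc.IH[OF l(1-3)] type_extends_refl[OF l(2), of s d m g1] by blast
    next
      case True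
      then have s: "1 \<le> s" "s \<le> m" using l(5) by auto
      obtain e where e: "e \<in> X" "e \<notin> Y1" "katetov d m (insert e Y1) (g1(e := s))"
        using drop_level[OF l(1-3) s] .
      have "level_type d m s (insert e Y1) (g1(e := s))"
        unfolding level_type_def using l(1,4) e(3) by (auto intro: Suc_leD)
      then have "type_extends X d m s Y1 g1 (insert e Y1) (g1(e := s))"
        unfolding type_extends_def using e(1,2) l(2) by auto
      moreover have "large X d m \<Gamma> s (insert e Y1) (g1(e := s))"
        using l(1,2) e(1) by (intro Suc.IH[OF _ _ e(3)]) auto
      ultimately show ?thesis by blast
    qed
  qed
qed

section \<open>Monochromatic copies\<close>

lemma (in urysohn_space) refine_to_level:
  assumes sys: "large_system d m \<Gamma> X T" and F: "finite F" "F \<noteq> {}" "F \<subseteq> X"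
    and top: "\<And>V g. F \<subseteq> V \<Longrightarrow> V \<subseteq> X \<Longrightarrow> level_type d m m V g \<Longrightarrow> \<forall>w\<in>F. g w = m \<Longrightarrow> T m V g"
    and r: "1 \<le> r" "r \<le> m"
  shows "\<exists>E T'. F \<subseteq> E \<and> E \<subseteq> X \<and> urysohn_space E d m \<and> large_system d m \<Gamma> E T' \<and>
     (\<forall>V g. F \<subseteq> V \<and> V \<subseteq> E \<and> level_type d m r V g \<and> (\<forall>w\<in>F. g w = m) \<longrightarrow> T' r V g)"
  using r(2)
proof (induction rule: inc_induct)
  case base
  show ?case using F(3) sys top urysohn_space_axioms by (intro exI[of _ X] exI[of _ T]) blast
next
  case (step n)
  from step.IH obtain E T' where E': "F \<subseteq> E \<and> E \<subseteq> X \<and> urysohn_space E d m \<and> large_system d m \<Gamma> E T' \<and>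
     (\<forall>V g. F \<subseteq> V \<and> V \<subseteq> E \<and> level_type d m (Suc n) V g \<and> (\<forall>w\<in>F. g w = m) \<longrightarrow> T' (Suc n) V g)"
    by (elim exE)
  then have E: "F \<subseteq> E" "E \<subseteq> X" "urysohn_space E d m" "large_system d m \<Gamma> E T'"
      "\<And>V g. F \<subseteq> V \<Longrightarrow> V \<subseteq> E \<Longrightarrow> level_type d m (Suc n) V g \<Longrightarrow> \<forall>w\<in>F. g w = m \<Longrightarrow> T' (Suc n) V g"
    by simp_all
  interpret E: urysohn_space E d m by (rule E)
  interpret E: refinement E d m \<Gamma> F T' n
    by unfold_locales (use E F step r in auto)
  obtain E' T'' where "F \<subseteq> E'" "E' \<subseteq> E" "urysohn_space E' d m" "large_system d m \<Gamma> E' T''"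
      "\<forall>V g. F \<subseteq> V \<and> V \<subseteq> E' \<and> level_type d m n V g \<and> (\<forall>w\<in>F. g w = m) \<longrightarrow> T'' n V g"
    using E.refine by blast
  then show ?case using E(2) by (intro exI[of _ E'] exI[of _ T'']) auto
qed

text \<open>
The points of \<open>X\<close> are mapped one at a time. Keeping all images at distance \<open>m\<close> from \<open>F\<close> is no
restriction, because \<open>m\<close> is the largest distance, and it ensures that the types to be realised are \<open>m\<close>
on \<open>F\<close>.
\<close>

lemma (in nat_metric) copy_in_colour:
  assumes X: "countable X" "X \<noteq> {}" and m: "1 \<le> m" and F: "finite F" "F \<noteq> {}" "F \<subseteq> E" and EX: "E \<subseteq> X"
    and E: "\<And>V g. finite V \<Longrightarrow> F \<subseteq> V \<Longrightarrow> V \<subseteq> E \<Longrightarrow> katetov d m V g \<Longrightarrow> \<forall>w\<in>F. g w = m \<Longrightarrow>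
      \<exists>e\<in>E \<inter> \<Gamma>. \<forall>y\<in>V. d e y = g y"
  obtains \<phi> where "\<And>x. x \<in> X \<Longrightarrow> \<phi> x \<in> E \<inter> \<Gamma>" "\<And>x y. x \<in> X \<Longrightarrow> y \<in> X \<Longrightarrow> d (\<phi> x) (\<phi> y) = d x y"
proof -
  define q where "q = from_nat_into X"
  have qX: "q n \<in> X" for n unfolding q_def using from_nat_into[OF X(2)] .
  have qsurj: "\<exists>n. q n = x" if "x \<in> X" for x unfolding q_def using from_nat_into_surj[OF X(1) that] .
  define ok where "ok n c \<longleftrightarrow> (\<forall>i<n. c i \<in> E \<inter> \<Gamma> \<and> (\<forall>w\<in>F. d (c i) w = m) \<and>
      (\<forall>j<n. d (c i) (c j) = d (q i) (q j)))" for n and c :: "nat \<Rightarrow> 'a"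
  have "\<exists>f. \<forall>n. ok n (f n) \<and> (\<forall>i<n. f (Suc n) i = f n i)"
  proof (rule dependent_nat_choice)
    show "\<exists>c. ok 0 c" unfolding ok_def by simp
    fix c n assume ok: "ok n c"
    have c: "c i \<in> E" "c i \<in> \<Gamma>" "c i \<in> X" "\<And>w. w \<in> F \<Longrightarrow> d (c i) w = m" "\<And>j. j < n \<Longrightarrow> d (c i) (c j) = d (q i) (q j)"
      if "i < n" for i using ok that EX unfolding ok_def by auto
    have step: "ok (Suc n) (c(n := e))"
      if e: "e \<in> E" "e \<in> \<Gamma>" "\<And>w. w \<in> F \<Longrightarrow> d e w = m" "\<And>i. i < n \<Longrightarrow> d e (c i) = d (q n) (q i)" for e
    proof -
      have "d e e = d (q n) (q n)" using d_zero[of e e] d_zero[of "q n" "q n"] e(1) EX qX by auto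
      moreover have "d (c i) e = d (q i) (q n)" if "i < n" for i
        using e(4)[OF that] d_sym[of e "c i"] d_sym[of "q n" "q i"] c(3)[OF that] e(1) EX qX by auto
      ultimately show ?thesis unfolding ok_def using c e by (auto simp: less_Suc_eq)
    qed
    have "\<exists>e. e \<in> E \<and> e \<in> \<Gamma> \<and> (\<forall>w\<in>F. d e w = m) \<and> (\<forall>i<n. d e (c i) = d (q n) (q i))"
    \<comment> \<open>The enumeration \<open>q\<close> of \<open>X\<close> may repeat points.\<close>
    proof (cases "\<exists>j<n. q j = q n")
      case True
      then obtain j where j: "j < n" "q j = q n" by blast
      then show ?thesis using c[OF j(1)] by (intro exI[of _ "c j"]) auto
    next
      case False
      define g where "g y = (if y \<in> F then m else d (q n) (q (SOME i. i < n \<and> c i = y)))" for y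
      have cF: "c i \<notin> F" if "i < n" for i
        using c(4)[OF that, of "c i"] d_zero[of "c i" "c i"] c(3)[OF that] m by auto
      have gc: "g (c i) = d (q n) (q i)" if i: "i < n" for i
      proof -
        let ?i = "SOME k. k < n \<and> c k = c i"
        have *: "?i < n \<and> c ?i = c i" by (rule someI[of _ i]) (use i in simp)
        then have "d (q ?i) (q i) = 0" using c(5)[of ?i i] i d_zero[of "c i" "c i"] c(3)[OF i] by simp
        then have "q ?i = q i" using d_zero qX by blast
        then show ?thesis unfolding g_def using cF[OF i] by simp
      qed
      have gF: "g w = m" if "w \<in> F" for w using that unfolding g_def by simp
      let ?V = "F \<union> c ` {..<n}"
      have FX: "w \<in> X" if "w \<in> F" for w using F(3) EX that by blast
      have dm: "d x y \<le> m" if "x \<in> X" "y \<in> X" for x y using d_le that .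
      have pos: "1 \<le> d (q n) (q i)" if "i < n" for i using d_zero[of "q n" "q i"] qX False that by force
      have tri: "d (q n) (q i) \<le> d (q n) (q j) + d (c i) (c j)" "d (c i) (c j) \<le> d (q n) (q i) + d (q n) (q j)"
        if "i < n" "j < n" for i j
        using d_tri[of "q n" "q j" "q i"] d_tri[of "q i" "q n" "q j"] d_sym[of "q i" "q n"] d_sym[of "q i" "q j"]
          c(5)[OF that] qX by simp_all
      have kat: "katetov d m ?V g"
        unfolding katetov_def
      proof (intro conjI ballI)
        fix x assume x: "x \<in> ?V"
        show "1 \<le> g x" using x gF gc pos m by auto
        show "g x \<le> m" using x gF gc dm qX by auto
        fix y assume y: "y \<in> ?V"
        have dsym: "d x y = d y x" using x y FX c(3) by (intro d_sym) auto
        have "g x \<le> g y + d x y \<and> d x y \<le> g x + g y"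
        proof (cases "x \<in> F \<or> y \<in> F")
          case True
          have "g x \<le> m" "d x y \<le> m" using x y FX c(3) dm gF gc qX by auto
          moreover have "g x = m \<or> g y = m" using True gF by blast
          moreover have "(g x = m \<and> g y = m) \<or> d x y = m"
          proof (cases "x \<in> F \<and> y \<in> F")
            case True then show ?thesis using gF by blast
          next
            case False
            then have "(x \<in> F \<and> y \<in> c ` {..<n}) \<or> (x \<in> c ` {..<n} \<and> y \<in> F)" using True x y by blast
            then show ?thesis using c(4) dsym by auto
          qed
          ultimately show ?thesis by linarith
        next
          case False
          then show ?thesis using x y gc tri by auto
        qed
        then show "g x \<le> g y + d x y" "d x y \<le> g x + g y" by auto
      qed
      have "finite ?V" "F \<subseteq> ?V" "?V \<subseteq> E" using F c(1) by auto
      then obtain e where "e \<in> E \<inter> \<Gamma>" "\<forall>y\<in>?V. d e y = g y" using E[OF _ _ _ kat] gF by blast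
      then show ?thesis using gF gc by (intro exI[of _ e]) auto
    qed
    then obtain e where "e \<in> E" "e \<in> \<Gamma>" "\<forall>w\<in>F. d e w = m" "\<forall>i<n. d e (c i) = d (q n) (q i)" by blast
    then have "ok (Suc n) (c(n := e))" by (intro step) auto
    then show "\<exists>c'. ok (Suc n) c' \<and> (\<forall>i<n. c' i = c i)" by (intro exI[of _ "c(n := e)"]) simp
  qed
  then obtain f where f: "\<And>n. ok n (f n)" "\<And>n i. i < n \<Longrightarrow> f (Suc n) i = f n i" by blast
  define C where "C i = f (Suc i) i" for i
  have fC: "f n i = C i" if "i < n" for n i
    using Suc_leI[OF that] by (induction n rule: dec_induct) (simp_all add: C_def f(2))
  have C: "C i \<in> E \<inter> \<Gamma>" "d (C i) (C j) = d (q i) (q j)" for i j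
  proof -
    let ?n = "Suc (max i j)"
    have ij: "i < ?n" "j < ?n" by auto
    have "f ?n i \<in> E \<inter> \<Gamma>" "d (f ?n i) (f ?n j) = d (q i) (q j)" using f(1)[of ?n] ij unfolding ok_def by blast+
    then show "C i \<in> E \<inter> \<Gamma>" "d (C i) (C j) = d (q i) (q j)" using fC[OF ij(1)] fC[OF ij(2)] by simp_all
  qed
  define idx where "idx x = (SOME n. q n = x)" for x
  have idx: "q (idx x) = x" if "x \<in> X" for x unfolding idx_def using someI_ex[OF qsurj[OF that]] .
  show thesis
    by (rule that[of "\<lambda>x. C (idx x)"]) (use C idx in auto)
qed

lemma (in urysohn_space) monochromatic_copy:
  assumes m: "1 \<le> m" and c: "c \<in> X \<rightarrow> {0..<k}"
  obtains i \<phi> where "\<And>x. x \<in> X \<Longrightarrow> \<phi> x \<in> X \<and> c (\<phi> x) = (i::nat)"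
    "\<And>x y. x \<in> X \<Longrightarrow> y \<in> X \<Longrightarrow> d (\<phi> x) (\<phi> y) = d x y"
proof -
  obtain a where a: "a \<in> X" using realise[of "{}" "\<lambda>_. m"] unfolding katetov_def by auto
  have daa: "d a a = 0" using d_zero a by blast
  have ka: "katetov d m {a} (\<lambda>_. m)" unfolding katetov_def using m daa by simp
  have la: "level_type d m m {a} (\<lambda>_. m)" unfolding level_type_def using ka by simp
  obtain k' where k': "k = Suc k'" using c a by (cases k) auto
  let ?\<Gamma> = "\<lambda>i. {x. c x = i}"
  have "large X d m (\<Union>i<Suc k'. ?\<Gamma> i) m {a} (\<lambda>_. m)"
    using a ka c k' by (intro large_everything) auto
  from large_UN[OF this _ la] obtain i F g
    where Fg: "type_extends X d m m {a} (\<lambda>_. m) F g" "large X d m (?\<Gamma> i) m F g"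
    using a by blast
  have F: "{a} \<subseteq> F" "F \<subseteq> X" "level_type d m m F g" using Fg(1) m unfolding type_extends_def by auto
  have gm: "g w = m" if "w \<in> F" for w
    using F(3) that unfolding level_type_def katetov_def by (simp add: antisym)
  have finF: "finite F" "F \<noteq> {}" using F(1,3) unfolding level_type_def by auto
  let ?T = "\<lambda>s Y g. Y \<subseteq> X \<and> level_type d m s Y g \<and> large X d m (?\<Gamma> i) s Y g"
  note sys = large_system_large[of d m "?\<Gamma> i" X]
  have top: "?T m V h" if "F \<subseteq> V" "V \<subseteq> X" "level_type d m m V h" "\<forall>w\<in>F. h w = m" for V h
  proof -
    obtain m' where m': "m = Suc m'" using m by (cases m) auto
    have "type_extends X d m m F g V h" unfolding type_extends_def using that gm by auto
    then have "large X d m (?\<Gamma> i) m V h" using Fg(2) large_type_extends[of X d m "?\<Gamma> i" m'] m' by simp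
    then show ?thesis using that by blast
  qed
  have "\<exists>E T'. F \<subseteq> E \<and> E \<subseteq> X \<and> urysohn_space E d m \<and> large_system d m (?\<Gamma> i) E T' \<and>
     (\<forall>V g. F \<subseteq> V \<and> V \<subseteq> E \<and> level_type d m 1 V g \<and> (\<forall>w\<in>F. g w = m) \<longrightarrow> T' 1 V g)"
    by (rule refine_to_level[OF sys finF F(2) top order_refl m]) assumption+
  then obtain E T' where "F \<subseteq> E \<and> E \<subseteq> X \<and> urysohn_space E d m \<and> large_system d m (?\<Gamma> i) E T' \<and>
     (\<forall>V g. F \<subseteq> V \<and> V \<subseteq> E \<and> level_type d m 1 V g \<and> (\<forall>w\<in>F. g w = m) \<longrightarrow> T' 1 V g)"
    by (elim exE)
  then have E: "F \<subseteq> E" "E \<subseteq> X" "urysohn_space E d m" "large_system d m (?\<Gamma> i) E T'"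
      "\<And>V g. F \<subseteq> V \<Longrightarrow> V \<subseteq> E \<Longrightarrow> level_type d m 1 V g \<Longrightarrow> \<forall>w\<in>F. g w = m \<Longrightarrow> T' 1 V g"
    by simp_all
  interpret E: urysohn_space E d m by (rule E)
  note E8 = large_systemD(8)[OF E(4)]
  have real: "\<exists>e\<in>E \<inter> ?\<Gamma> i. \<forall>y\<in>V. d e y = g y"
    if V: "finite V" "F \<subseteq> V" "V \<subseteq> E" and g: "katetov d m V g" "\<forall>w\<in>F. g w = m" for V g
  proof -
    \<comment> \<open>A further point lowers the level of \<open>g\<close> to 1.\<close>
    obtain e where e: "e \<in> E" "e \<notin> V" "katetov d m (insert e V) (g(e := 1))"
      using E.drop_level[OF V(1,3) g(1) order_refl m] .
    have "level_type d m 1 (insert e V) (g(e := 1))"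
      unfolding level_type_def using V(1) e(3) katetovD(1)[OF g(1)] by auto
    moreover have "\<forall>w\<in>F. (g(e := 1)) w = m" using g(2) V(2) e(2) by auto
    ultimately have "T' 1 (insert e V) (g(e := 1))" using E(5) V(2,3) e(1) by blast
    from E8[OF this] obtain x where "x \<in> E \<inter> ?\<Gamma> i" "\<forall>y\<in>insert e V. d x y = (g(e := 1)) y"
      by blast
    then show ?thesis using e(2) by (intro bexI[of _ x]) auto
  qed
  have "X \<noteq> {}" using a by blast
  obtain \<phi> where "\<And>x. x \<in> X \<Longrightarrow> \<phi> x \<in> E \<inter> ?\<Gamma> i" "\<And>x y. x \<in> X \<Longrightarrow> y \<in> X \<Longrightarrow> d (\<phi> x) (\<phi> y) = d x y"
    using copy_in_colour[OF countable \<open>X \<noteq> {}\<close> m finF E(1,2) real] by blast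
  then show thesis using that[of \<phi> i] E(2) by blast
qed

section \<open>Types are realised in \<open>\<^bold>U\<^sub>m\<close>\<close>

lemma finite_subspace_nat_copy:
  assumes "finite S" "S \<subseteq> mspace X"
  obtains N :: "nat metric" where "finite (mspace N)" "isometric N (submetric X S)"
proof -
  obtain \<psi> where \<psi>: "bij_betw \<psi> {0..<card S} S" using ex_bij_betw_nat_finite[OF assms(1)] by blast
  let ?D = "\<lambda>i j. mdist X (\<psi> i) (\<psi> j)"
  have inX: "\<psi> i \<in> mspace X" if "i \<in> {0..<card S}" for i using \<psi> that assms(2) bij_betwE by blast
  interpret N: Metric_space "{0..<card S}" ?D
  proof
    show "?D i j = 0 \<longleftrightarrow> i = j" if "i \<in> {0..<card S}" "j \<in> {0..<card S}" for i j
      using mdist_zero[OF inX inX, OF that] that inj_on_eq_iff[OF bij_betw_imp_inj_on[OF \<psi>]] by blast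
    show "?D i k \<le> ?D i j + ?D j k"
      if "i \<in> {0..<card S}" "j \<in> {0..<card S}" "k \<in> {0..<card S}" for i j k
      using mdist_triangle[OF inX inX inX, OF that] .
  qed (simp_all add: mdist_commute)
  let ?N = "metric ({0..<card S}, ?D)"
  have "isometry_onto ?N (submetric X S) \<psi>"
    unfolding isometry_onto_def using \<psi> assms(2) by (simp add: Int_absorb2)
  then have "isometric ?N (submetric X S)" unfolding isometric_def by blast
  then show thesis by (rule that[rotated]) simp
qed

lemma is_U_distances:
  assumes U: "is_U m X" and xy: "x \<in> mspace X" "y \<in> mspace X" "x \<noteq> y"
  shows "mdist X x y \<in> real ` {1..m}"
proof -
  obtain N :: "nat metric" where N: "finite (mspace N)" "isometric N (submetric X {x, y})"
    using finite_subspace_nat_copy[of "{x, y}" X] xy by auto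
  have "finite {x, y} \<and> {x, y} \<subseteq> mspace X \<and> isometric N (submetric X {x, y})" using N xy by simp
  then have "distances_upto m N" using U N(1) unfolding is_U_def by blast
  moreover obtain f where f: "isometry_onto N (submetric X {x, y}) f" using N(2) unfolding isometric_def by blast
  have "f ` mspace N = {x, y}" using f xy unfolding isometry_onto_def bij_betw_def by auto
  then obtain i j where ij: "i \<in> mspace N" "j \<in> mspace N" "f i = x" "f j = y" by (metis imageE insertCI)
  then have "mdist X x y = mdist N i j" "i \<noteq> j" using f xy(3) unfolding isometry_onto_def by auto
  ultimately show ?thesis using ij unfolding distances_upto_def by auto
qed

text \<open>
The one-point extension of \<open>Y\<close> described by \<open>g\<close> is a finite space with distances in \<open>{1..m}\<close>, so it has
a copy \<open>S\<close> in \<open>X\<close>. Ultrahomogeneity moves the copy of \<open>Y\<close> inside \<open>S\<close> back to \<open>Y\<close>, and with it the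
remaining point of \<open>S\<close> to a realisation of \<open>g\<close>.
\<close>

lemma is_U_realise:
  fixes X :: "'a metric"
  assumes U: "is_U m X" and Y: "finite Y" "Y \<subseteq> mspace X"
    and d: "\<And>x y. x \<in> mspace X \<Longrightarrow> y \<in> mspace X \<Longrightarrow> mdist X x y = real (d x y)"
    and g: "katetov d m Y g"
  shows "\<exists>e\<in>mspace X. \<forall>y\<in>Y. d e y = g y"
proof -
  define n where "n = card Y"
  obtain \<psi> where \<psi>: "bij_betw \<psi> {0..<n} Y" unfolding n_def using ex_bij_betw_nat_finite[OF Y(1)] by blast
  have \<psi>Y: "\<psi> i \<in> Y" if "i < n" for i using \<psi> that bij_betwE by fastforce
  have \<psi>X: "\<psi> i \<in> mspace X" if "i < n" for i using \<psi>Y[OF that] Y(2) by blast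
  have \<psi>inj: "\<psi> i = \<psi> j \<longleftrightarrow> i = j" if "i < n" "j < n" for i j
    using that inj_on_eq_iff[OF bij_betw_imp_inj_on[OF \<psi>]] by simp
  \<comment> \<open>The number \<open>n\<close> is the new point, the smaller numbers enumerate \<open>Y\<close>.\<close>
  define D where "D i j = (if i = j then 0 else if i = n then real (g (\<psi> j)) else if j = n then real (g (\<psi> i))
      else mdist X (\<psi> i) (\<psi> j))" for i j
  have gk: "1 \<le> g (\<psi> i)" "g (\<psi> i) \<le> m" if "i < n" for i using katetovD(1,2)[OF g \<psi>Y[OF that]] .
  have tri: "real (g (\<psi> i)) \<le> real (g (\<psi> j)) + mdist X (\<psi> i) (\<psi> j)"
      "mdist X (\<psi> i) (\<psi> j) \<le> real (g (\<psi> i)) + real (g (\<psi> j))" if "i < n" "j < n" for i j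
    using katetovD(3,4)[OF g \<psi>Y \<psi>Y, OF that] d[OF \<psi>X \<psi>X, OF that] by linarith+
  have tri': "mdist X (\<psi> i) (\<psi> k) \<le> mdist X (\<psi> i) (\<psi> j) + mdist X (\<psi> j) (\<psi> k)"
    if "i < n" "j < n" "k < n" for i j k using mdist_triangle[OF \<psi>X \<psi>X \<psi>X, OF that] .
  have zero: "mdist X (\<psi> i) (\<psi> j) = 0 \<longleftrightarrow> i = j" if "i < n" "j < n" for i j
    using mdist_zero[OF \<psi>X \<psi>X, OF that] \<psi>inj[OF that] by simp
  interpret N: Metric_space "{..n}" D
  proof
    show "0 \<le> D x y" for x y unfolding D_def by simp
    show "D x y = D y x" for x y unfolding D_def by (simp add: mdist_commute)
    show "D x y = 0 \<longleftrightarrow> x = y" if "x \<in> {..n}" "y \<in> {..n}" for x y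
      using that zero[of x y] gk(1)[of x] gk(1)[of y] unfolding D_def by (auto simp: le_less)
    show "D x z \<le> D x y + D y z" if "x \<in> {..n}" "y \<in> {..n}" "z \<in> {..n}" for x y z
    proof -
      have "x < n \<or> x = n" "y < n \<or> y = n" "z < n \<or> z = n" using that by auto
      then show ?thesis
        using tri[of x y] tri[of y z] tri[of x z] tri[of z y] tri'[of x y z] mdist_commute[of X "\<psi> y" "\<psi> z"]
        unfolding D_def by auto
    qed
  qed
  let ?N = "metric ({..n}, D)"
  have "distances_upto m ?N"
    unfolding distances_upto_def
  proof (intro ballI impI)
    fix x y assume "x \<in> mspace ?N" "y \<in> mspace ?N" "x \<noteq> y"
    then have xy: "x \<le> n" "y \<le> n" "x \<noteq> y" by simp_all
    have "D x y \<in> real ` {1..m}"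
    proof (cases "x = n \<or> y = n")
      case True
      then show ?thesis using xy gk[of x] gk[of y] unfolding D_def by auto
    next
      case False
      then have "\<psi> x \<noteq> \<psi> y" using xy \<psi>inj by simp
      then show ?thesis
        using False xy is_U_distances[OF U \<psi>X \<psi>X, of x y] unfolding D_def by simp
    qed
    then show "mdist ?N x y \<in> real ` {1..m}" by simp
  qed
  moreover have "finite (mspace ?N)" by simp
  ultimately obtain S where S: "finite S" "S \<subseteq> mspace X" "isometric ?N (submetric X S)"
    using U unfolding is_U_def by blast
  then obtain \<phi> where "isometry_onto ?N (submetric X S) \<phi>" unfolding isometric_def by blast
  then have \<phi>: "bij_betw \<phi> {..n} S" "\<And>i j. i \<le> n \<Longrightarrow> j \<le> n \<Longrightarrow> mdist X (\<phi> i) (\<phi> j) = D i j"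
    unfolding isometry_onto_def using S(2) by (auto simp: Int_absorb2)
  have \<phi>X: "\<phi> i \<in> mspace X" if "i \<le> n" for i using \<phi>(1) that S(2) bij_betwE by fastforce
  define S0 where "S0 = \<phi> ` {0..<n}"
  have b0: "bij_betw \<phi> {0..<n} S0" unfolding S0_def
    by (rule bij_betw_subset[OF \<phi>(1)]) auto
  define h where "h = \<psi> \<circ> the_inv_into {0..<n} \<phi>"
  have h\<phi>: "h (\<phi> i) = \<psi> i" if "i < n" for i
    unfolding h_def using b0 that by (simp add: the_inv_into_f_f bij_betw_def)
  have hb: "bij_betw h S0 Y"
    unfolding h_def by (rule bij_betw_trans[OF bij_betw_the_inv_into[OF b0] \<psi>])
  have S0X: "S0 \<subseteq> mspace X" unfolding S0_def using \<phi>X by auto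
  have "isometry_onto (submetric X S0) (submetric X Y) h"
    unfolding isometry_onto_def
  proof (intro conjI ballI)
    show "bij_betw h (mspace (submetric X S0)) (mspace (submetric X Y))"
      using hb S0X Y(2) by (simp add: Int_absorb2)
    fix x y assume "x \<in> mspace (submetric X S0)" "y \<in> mspace (submetric X S0)"
    then obtain i j where ij: "i < n" "j < n" "x = \<phi> i" "y = \<phi> j" unfolding S0_def by auto
    then show "mdist (submetric X Y) (h x) (h y) = mdist (submetric X S0) x y"
      using h\<phi> \<phi>(2)[of i j] zero[of i j] unfolding D_def by auto
  qed
  moreover have "finite S0" unfolding S0_def by simp
  ultimately have pre: "finite S0 \<and> S0 \<subseteq> mspace X \<and> finite Y \<and> Y \<subseteq> mspace X \<and>
      isometry_onto (submetric X S0) (submetric X Y) h" using Y S0X by blast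
  have "ultrahomogeneous X" using U unfolding is_U_def by blast
  from this[unfolded ultrahomogeneous_def, rule_format, OF pre]
  obtain G where G: "isometry_onto X X G" "\<forall>x\<in>S0. G x = h x" by blast
  have GX: "G (\<phi> n) \<in> mspace X" using G(1) \<phi>X unfolding isometry_onto_def bij_betw_def by blast
  have "d (G (\<phi> n)) y = g y" if "y \<in> Y" for y
  proof -
    have "y \<in> \<psi> ` {0..<n}" using bij_betw_imp_surj_on[OF \<psi>] that by simp
    then obtain i where i: "i < n" "y = \<psi> i" by auto
    have "\<phi> i \<in> S0" unfolding S0_def using i by simp
    then have "G (\<phi> i) = y" using G(2) h\<phi> i by simp
    moreover have "mdist X (G (\<phi> n)) (G (\<phi> i)) = mdist X (\<phi> n) (\<phi> i)"
      using G(1) \<phi>X[of n] \<phi>X[of i] i(1) unfolding isometry_onto_def by simp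
    moreover have "mdist X (\<phi> n) (\<phi> i) = real (g y)" using \<phi>(2)[of n i] i unfolding D_def by simp
    ultimately have "real (d (G (\<phi> n)) y) = real (g y)" using d[OF GX, of y] that Y(2) by auto
    then show ?thesis by simp
  qed
  then show ?thesis using GX by blast
qed

lemma is_U_urysohn_space:
  fixes X :: "'a metric"
  assumes U: "is_U m X"
  obtains d where "urysohn_space (mspace X) d m"
    "\<And>x y. x \<in> mspace X \<Longrightarrow> y \<in> mspace X \<Longrightarrow> mdist X x y = real (d x y)"
proof -
  define d where "d x y = nat \<lfloor>mdist X x y\<rfloor>" for x y
  have val: "mdist X x y = real (d x y) \<and> d x y \<le> m" if xy: "x \<in> mspace X" "y \<in> mspace X" for x y
  proof (cases "x = y")
    case True then show ?thesis using mdist_zero[OF xy] unfolding d_def by simp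
  next
    case False
    then obtain k where "k \<in> {1..m}" "mdist X x y = real k" using is_U_distances[OF U xy False] by blast
    then show ?thesis unfolding d_def by simp
  qed
  have "urysohn_space (mspace X) d m"
  proof
    fix x y assume xy: "x \<in> mspace X" "y \<in> mspace X"
    show "d x y = 0 \<longleftrightarrow> x = y" using val[OF xy] mdist_zero[OF xy] by simp
    show "d x y = d y x" unfolding d_def by (simp add: mdist_commute)
    show "d x y \<le> m" using val[OF xy] by simp
    fix z assume z: "z \<in> mspace X"
    show "d x z \<le> d x y + d y z"
      using mdist_triangle[OF xy z] val[OF xy] val[OF xy(2) z] val[OF xy(1) z] by simp
  next
    show "countable (mspace X)" using U unfolding is_U_def by blast
  next
    fix Y g assume "finite Y" "Y \<subseteq> mspace X" "katetov d m Y g"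
    then show "\<exists>e\<in>mspace X. \<forall>y\<in>Y. d e y = g y" using is_U_realise[OF U, of Y d g] val by blast
  qed
  then show thesis using that val by blast
qed

section \<open>Indivisibility\<close>

theorem theorem57:
  fixes m :: nat and X :: "'a metric"
  assumes "m \<ge> 1"
    and "is_U m X"
  shows "indivisible X"
  unfolding indivisible_def
proof (intro allI impI ballI)
  fix k :: nat and c assume c: "c \<in> mspace X \<rightarrow> {0..<k}"
  obtain d where d: "urysohn_space (mspace X) d m"
    "\<And>x y. x \<in> mspace X \<Longrightarrow> y \<in> mspace X \<Longrightarrow> mdist X x y = real (d x y)"
    using is_U_urysohn_space[OF assms(2)] by blast
  obtain i \<phi> where \<phi>: "\<And>x. x \<in> mspace X \<Longrightarrow> \<phi> x \<in> mspace X \<and> c (\<phi> x) = i"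
    "\<And>x y. x \<in> mspace X \<Longrightarrow> y \<in> mspace X \<Longrightarrow> d (\<phi> x) (\<phi> y) = d x y"
    by (rule urysohn_space.monochromatic_copy[OF d(1) assms(1) c]) (rule that; assumption)
  have iso: "mdist X (\<phi> x) (\<phi> y) = mdist X x y" if "x \<in> mspace X" "y \<in> mspace X" for x y
    using d(2) \<phi> that by simp
  have inj: "inj_on \<phi> (mspace X)"
  proof (rule inj_onI)
    fix x y assume xy: "x \<in> mspace X" "y \<in> mspace X" "\<phi> x = \<phi> y"
    then have "mdist X x y = 0" using iso[of x y] \<phi>(1)[of y] mdist_zero[of "\<phi> y" X "\<phi> y"] by simp
    then show "x = y" using mdist_zero[OF xy(1,2)] by simp
  qed
  let ?S = "\<phi> ` mspace X"
  have S: "?S \<subseteq> mspace X" using \<phi>(1) by blast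
  have "isometry_onto (submetric X ?S) X (the_inv_into (mspace X) \<phi>)"
    unfolding isometry_onto_def
  proof (intro conjI ballI)
    show "bij_betw (the_inv_into (mspace X) \<phi>) (mspace (submetric X ?S)) (mspace X)"
      using bij_betw_the_inv_into[OF inj_on_imp_bij_betw[OF inj]] S by (simp add: Int_absorb2)
    fix x y assume "x \<in> mspace (submetric X ?S)" "y \<in> mspace (submetric X ?S)"
    then obtain u v where "u \<in> mspace X" "v \<in> mspace X" "x = \<phi> u" "y = \<phi> v" by auto
    then show "mdist X (the_inv_into (mspace X) \<phi> x) (the_inv_into (mspace X) \<phi> y) =
        mdist (submetric X ?S) x y"
      using iso the_inv_into_f_f[OF inj] by simp
  qed
  then have "isometric (submetric X ?S) X" unfolding isometric_def by blast
  moreover have "c constant_on ?S" unfolding constant_on_def using \<phi>(1) by blast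
  ultimately show "\<exists>S. S \<subseteq> mspace X \<and> isometric (submetric X S) X \<and> c constant_on S"
    using S by blast
qed

end
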